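(* Fix $\delta\in[0,1/2)$. There is a constant $c>0$ depending only on $\delta$ such that for every $k\ge 2$, $\mathsf{PIC}_{\zeta_2,\delta}(\mathsf{Disj}_2)\ge c\,k$; that is, $\mathsf{PIC}_{\zeta_2,\delta}(\mathsf{Disj}_2)=\Omega(k)$.
   Context: Coordinator model: $k$ processors and a coordinator; input a $k\times 2$ Boolean matrix $X$, processor $i$ privately holds row $X^i\in\{0,1\}^2$, the coordinator has no input, each processor has a private channel only to the coordinator, all parties have private coins. A protocol is $\delta$-error for $f$ if on every input it is correct with probability at least $1-\delta$. $\Pi^i(X)$ denotes processor $i$'s view of the transcript (messages exchanged between processor $i$ and the coordinator). $\mathsf{Disj}_2(A)=1$ iff some column of the $k\times 2$ Boolean matrix $A$ is all ones. Distribution $\zeta_2$ on $(\mathbf X,\mathbf M,\mathbf Z,\mathbf W)$, $\mathbf X\in\{0,1\}^{k\times 2}$, $\mathbf M\in\{0,1\}^2$, $\mathbf Z\in[k]^2$, $\mathbf W\in\{1,2\}$: independently for each column $t\in\{1,2\}$, $\Pr[\mathbf M_t=1]=1/3$, $\mathbf Z_t$ uniform in $[k]$; processor $\mathbf Z_t$'s entry in column $t$ is $0$, every other entry is $1$ if $\mathbf M_t=1$ and an independent uniform bit if $\mathbf M_t=0$; then $\mathbf W$ is uniform in $\{1,2\}$ and column $\mathbf W$ is overwritten by all ones. $\mathsf{PIC}_{\zeta_2}(\Pi)=\sum_{i=1}^k\big(\mathbb I[\mathbf M_{-\mathbf W}:\Pi^i(\mathbf X)\mid \mathbf X^i,\mathbf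 Z,\mathbf W]+\mathbb I[\mathbf X^i_{-\mathbf W}:\Pi^i(\mathbf X)\mid \mathbf M,\mathbf Z,\mathbf W]\big)$, where $\mathbf M_{-\mathbf W}$ and $\mathbf X^i_{-\mathbf W}$ denote $\mathbf M$ and $\mathbf X^i$ with coordinate $\mathbf W$ removed; $\mathsf{PIC}_{\zeta_2,\delta}(\mathsf{Disj}_2)$ is the infimum of $\mathsf{PIC}_{\zeta_2}(\Pi)$ over $\delta$-error protocols $\Pi$ for $\mathsf{Disj}_2$. *)

theory Defs
  imports "HOL-Probability.Probability" "HOL-Library.While_Combinator"
begin

section \<open>Inputs\<close>

text \<open>
  A \<open>k \<times> 2\<close> Boolean matrix is a function from row indices to rows; the processors are
  \<open>0, \<dots>, k - 1\<close> and rows with index at least \<open>k\<close> carry no meaning. Columns are numbered 1 and 2.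
\<close>

type_synonym matrix = "nat \<Rightarrow> bool \<times> bool"

definition col :: "nat \<Rightarrow> 'a \<times> 'a \<Rightarrow> 'a" where
  "col t p = (if t = 1 then fst p else snd p)"

definition remove_coord :: "nat \<Rightarrow> 'a \<times> 'a \<Rightarrow> 'a" where
  "remove_coord t p = (if t = 1 then snd p else fst p)"

definition Disj2 :: "nat \<Rightarrow> matrix \<Rightarrow> bool" where
  "Disj2 k A \<longleftrightarrow> (\<exists>t\<in>{1, 2}. \<forall>i<k. col t (A i))"


section \<open>Protocols in the coordinator model\<close>

type_synonym message = "bool list"

text \<open>
  In each round the coordinator either halts with an output, or sends a (possibly empty) message to
  one processor, which sends a (possibly empty) message back. An entry \<open>(i, m, a)\<close> of a transcript
  records such a round: \<open>m\<close> goes to processor \<open>i\<close> and \<open>a\<close> is the answer.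
\<close>

datatype action = Send nat message | Halt bool

type_synonym transcript = "(nat \<times> message \<times> message) list"
type_synonym view = "(message \<times> message) list"

definition view_of :: "nat \<Rightarrow> transcript \<Rightarrow> view" where
  "view_of i \<tau> = map snd (filter (\<lambda>e. fst e = i) \<tau>)"

text \<open>
  The private coins of each party are one random draw, made before the execution starts. Given its
  coins, the coordinator acts as a function of the transcript so far, and processor \<open>i\<close> answers as a
  function of its row, its own view so far and the message it has just received.
\<close>

record protocol =
  coord_coins :: "nat pmf"
  proc_coins :: "nat \<Rightarrow> nat pmf"
  coord :: "nat \<Rightarrow> transcript \<Rightarrow> action"
  answer :: "nat \<Rightarrow> nat \<Rightarrow> bool \<times> bool \<Rightarrow> view \<Rightarrow> message \<Rightarrow> message"

type_synonym coins = "nat \<times> (nat \<Rightarrow> nat)"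

definition coins_pmf :: "nat \<Rightarrow> protocol \<Rightarrow> coins pmf" where
  "coins_pmf k P = pair_pmf (coord_coins P) (Pi_pmf {..<k} 0 (proc_coins P))"

definition running :: "protocol \<Rightarrow> coins \<Rightarrow> transcript \<Rightarrow> bool" where
  "running P \<rho> \<tau> \<longleftrightarrow> (\<exists>i m. coord P (fst \<rho>) \<tau> = Send i m)"

definition step :: "protocol \<Rightarrow> coins \<Rightarrow> matrix \<Rightarrow> transcript \<Rightarrow> transcript" where
  "step P \<rho> X \<tau> =
    (case coord P (fst \<rho>) \<tau> of
       Send i m \<Rightarrow> \<tau> @ [(i, m, answer P i (snd \<rho> i) (X i) (view_of i \<tau>) m)]
     | Halt b \<Rightarrow> \<tau>)"

definition run :: "protocol \<Rightarrow> coins \<Rightarrow> matrix \<Rightarrow> transcript option" where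
  "run P \<rho> X = while_option (running P \<rho>) (step P \<rho> X) []"

definition full_transcript :: "protocol \<Rightarrow> coins \<Rightarrow> matrix \<Rightarrow> transcript" where
  "full_transcript P \<rho> X = the (run P \<rho> X)"

definition result :: "protocol \<Rightarrow> coins \<Rightarrow> matrix \<Rightarrow> bool" where
  "result P \<rho> X \<longleftrightarrow> coord P (fst \<rho>) (full_transcript P \<rho> X) = Halt True"

definition is_protocol :: "nat \<Rightarrow> protocol \<Rightarrow> bool" where
  "is_protocol k P \<longleftrightarrow>
    (\<forall>r \<tau> i m. coord P r \<tau> = Send i m \<longrightarrow> i < k) \<and>
    (\<forall>\<rho>\<in>set_pmf (coins_pmf k P). \<forall>X. run P \<rho> X \<noteq> None)"

definition error_protocol :: "nat \<Rightarrow> real \<Rightarrow> (matrix \<Rightarrow> bool) \<Rightarrow> protocol \<Rightarrow> bool" where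
  "error_protocol k \<delta> f P \<longleftrightarrow>
    is_protocol k P \<and>
    (\<forall>X. measure_pmf.prob (coins_pmf k P) {\<rho>. result P \<rho> X = f X} \<ge> 1 - \<delta>)"


section \<open>The input distribution\<close>

definition column_pmf :: "nat \<Rightarrow> ((nat \<Rightarrow> bool) \<times> bool \<times> nat) pmf" where
  "column_pmf k =
    do {
      m \<leftarrow> bernoulli_pmf (1/3);
      z \<leftarrow> pmf_of_set {..<k};
      x \<leftarrow> Pi_pmf {..<k} False
        (\<lambda>i. if i = z then return_pmf False
             else if m then return_pmf True
             else bernoulli_pmf (1/2));
      return_pmf (x, m, z)
    }"

text \<open>The components of a sample are \<open>(X, M, Z, W)\<close>.\<close>

type_synonym sample = "matrix \<times> (bool \<times> bool) \<times> (nat \<times> nat) \<times> nat"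

definition zeta2 :: "nat \<Rightarrow> sample pmf" where
  "zeta2 k =
    do {
      (x1, m1, z1) \<leftarrow> column_pmf k;
      (x2, m2, z2) \<leftarrow> column_pmf k;
      w \<leftarrow> pmf_of_set {1, 2};
      return_pmf
        (\<lambda>i. (if w = 1 then True else x1 i, if w = 2 then True else x2 i),
         (m1, m2), (z1, z2), w)
    }"


section \<open>Information cost\<close>

text \<open>
  All random variables below take values in countable types, so that products of the counting
  measure spaces are again discrete. Information is measured in bits.
\<close>

definition cond_mutual_info ::
  "'s pmf \<Rightarrow> ('s \<Rightarrow> 'a) \<Rightarrow> ('s \<Rightarrow> 'b) \<Rightarrow> ('s \<Rightarrow> 'c) \<Rightarrow> real" where
  "cond_mutual_info p A B C =
    prob_space.conditional_mutual_information (measure_pmf p) 2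
      (count_space UNIV) (count_space UNIV) (count_space UNIV) A B C"

definition PIC_prot :: "nat \<Rightarrow> protocol \<Rightarrow> real" where
  "PIC_prot k P =
    (\<Sum>i<k.
      cond_mutual_info (pair_pmf (zeta2 k) (coins_pmf k P))
        (\<lambda>((X, M, Z, W), \<rho>). remove_coord W M)
        (\<lambda>((X, M, Z, W), \<rho>). view_of i (full_transcript P \<rho> X))
        (\<lambda>((X, M, Z, W), \<rho>). (X i, Z, W))
    + cond_mutual_info (pair_pmf (zeta2 k) (coins_pmf k P))
        (\<lambda>((X, M, Z, W), \<rho>). remove_coord W (X i))
        (\<lambda>((X, M, Z, W), \<rho>). view_of i (full_transcript P \<rho> X))
        (\<lambda>((X, M, Z, W), \<rho>). (M, Z, W)))"

definition PIC :: "nat \<Rightarrow> real \<Rightarrow> (matrix \<Rightarrow> bool) \<Rightarrow> ereal" where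
  "PIC k \<delta> f = (INF P \<in> {P. error_protocol k \<delta> f P}. ereal (PIC_prot k P))"

end

theory Submission
  imports Defs
begin

text \<open>
  Let \<open>T(X)\<close> be the law of the coordinator's coins and the transcript on input \<open>X\<close>. Its density is a
  product of a factor of the coordinator and one factor \<open>q\<^sub>i(X\<^sup>i, \<Pi>\<^sup>i)\<close> per processor, so the Hellinger
  distance of \<open>T(X)\<close> and \<open>T(Y)\<close> does not change when rows are exchanged between \<open>X\<close> and \<open>Y\<close> (cut and
  paste), and it equals that of the views of \<open>i\<close> if \<open>X\<close> and \<open>Y\<close> differ in row \<open>i\<close> only.

  Fix \<open>i \<noteq> z\<close> and let one column be all ones. Given \<open>Z = z\<close>, the two information terms of processor \<open>i\<close>
  bound the distances of its views between \<open>(x, m) = (1, 1)\<close> and \<open>(1, 0)\<close>, and between \<open>(1, 0)\<close> and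
  \<open>(0, 0)\<close>, where \<open>x\<close> is its entry in the other column and \<open>m\<close> the value of \<open>M\<close> there. By cut and
  paste they bound the distance between \<open>(1, 1)\<close> and \<open>(0, 1)\<close>, that is, between the columns with zero
  sets \<open>{z}\<close> and \<open>{i, z}\<close>. The same with \<open>i\<close> and \<open>z\<close> exchanged and another cut and paste show that the
  columns with zero sets \<open>{i}\<close>, \<open>{z}\<close> and \<open>{}\<close> are all close. A last cut and paste over both choices of
  the column of ones brings the all-ones matrix close to the matrix whose columns have zero sets \<open>{i}\<close>
  and \<open>{z}\<close>, on which the answer differs. So every pair \<open>i \<noteq> z\<close> contributes a constant to the sum
  of information terms, and averaging over \<open>Z\<close> gives \<open>\<Omega>(k)\<close>.
\<close>

section \<open>Hellinger distance\<close>

lemma pmf_summable_on: "pmf p summable_on A"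
proof -
  have "(\<lambda>x. norm (pmf p x)) summable_on A"
    using abs_summable_equivalent[of "pmf p" A] pmf_abs_summable by blast
  then show ?thesis by simp
qed

lemma infsum_pmf: "infsum (pmf p) A = measure_pmf.prob p A"
  by (simp add: infsetsum_infsum[symmetric] pmf_abs_summable measure_pmf_conv_infsetsum)

text \<open>This is twice the usual squared Hellinger distance.\<close>

definition hellinger :: "'a pmf \<Rightarrow> 'a pmf \<Rightarrow> real" where
  "hellinger P Q = (\<Sum>\<^sub>\<infinity>x. (sqrt (pmf P x) - sqrt (pmf Q x))\<^sup>2)"

lemma hellinger_summable: "(\<lambda>x. (sqrt (pmf P x) - sqrt (pmf Q x))\<^sup>2) summable_on A"
proof (rule summable_on_comparison_test)
  show "(\<lambda>x. pmf P x + pmf Q x) summable_on A"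
    by (intro summable_on_add pmf_summable_on)
  fix x
  have "0 \<le> sqrt (pmf P x) * sqrt (pmf Q x)" by simp
  then show "(sqrt (pmf P x) - sqrt (pmf Q x))\<^sup>2 \<le> pmf P x + pmf Q x"
    by (simp add: power2_diff)
qed simp

lemma hellinger_commute: "hellinger P Q = hellinger Q P"
  unfolding hellinger_def by (simp add: power2_commute)

lemma hellinger_nonneg: "0 \<le> hellinger P Q"
  unfolding hellinger_def by (simp add: infsum_nonneg)

text \<open>Squared distances satisfy the triangle inequality only up to the factor 2, which comes
  from \<open>(a + b)^2 <= 2 a^2 + 2 b^2\<close> pointwise.\<close>

lemma hellinger_triangle: "hellinger P R \<le> 2 * hellinger P Q + 2 * hellinger Q R"
proof -
  have "hellinger P R \<le> (\<Sum>\<^sub>\<infinity>x. 2 * (sqrt (pmf P x) - sqrt (pmf Q x))\<^sup>2 + 2 * (sqrt (pmf Q x) - sqrt (pmf R x))\<^sup>2)"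
    unfolding hellinger_def
  proof (rule infsum_mono)
    fix x
    have "0 \<le> ((sqrt (pmf P x) - sqrt (pmf Q x)) - (sqrt (pmf Q x) - sqrt (pmf R x)))\<^sup>2" by simp
    then show "(sqrt (pmf P x) - sqrt (pmf R x))\<^sup>2
      \<le> 2 * (sqrt (pmf P x) - sqrt (pmf Q x))\<^sup>2 + 2 * (sqrt (pmf Q x) - sqrt (pmf R x))\<^sup>2"
      by (simp add: power2_eq_square algebra_simps)
  qed (intro summable_on_add summable_on_cmult_right hellinger_summable)+
  also have "\<dots> = 2 * hellinger P Q + 2 * hellinger Q R"
    unfolding hellinger_def
    by (subst infsum_add) (auto intro!: summable_on_cmult_right hellinger_summable simp: infsum_cmult_right')
  finally show ?thesis .
qed

lemma sqrt_mult_le_add: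
  fixes a b :: real
  assumes "0 \<le> a" "0 \<le> b"
  shows "sqrt (a * b) \<le> a + b"
  by (rule order_trans[OF arith_geo_mean_sqrt[OF assms]]) (use assms in simp)

lemma sqrt_pmf_mult_summable: "(\<lambda>x. sqrt (pmf P x * pmf Q x)) summable_on A"
proof (rule summable_on_comparison_test)
  show "(\<lambda>x. pmf P x + pmf Q x) summable_on A"
    by (intro summable_on_add pmf_summable_on)
qed (simp_all add: sqrt_mult_le_add)

text \<open>The sum on the right is the Bhattacharyya coefficient. It sees \<open>P\<close> and
  \<open>Q\<close> only through their pointwise product, which is what makes cut and paste
  possible.\<close>

lemma hellinger_eq_affinity: "hellinger P Q = 2 - 2 * (\<Sum>\<^sub>\<infinity>x. sqrt (pmf P x * pmf Q x))"
proof -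
  have *: "(\<lambda>x. 2 * sqrt (pmf P x * pmf Q x)) summable_on UNIV"
    by (intro summable_on_cmult_right sqrt_pmf_mult_summable)
  have "hellinger P Q + (\<Sum>\<^sub>\<infinity>x. 2 * sqrt (pmf P x * pmf Q x))
      = (\<Sum>\<^sub>\<infinity>x. (sqrt (pmf P x) - sqrt (pmf Q x))\<^sup>2 + 2 * sqrt (pmf P x * pmf Q x))"
    unfolding hellinger_def by (rule infsum_add[symmetric, OF hellinger_summable *])
  also have "\<dots> = (\<Sum>\<^sub>\<infinity>x. pmf P x + pmf Q x)"
    by (rule infsum_cong) (simp add: power2_diff real_sqrt_mult)
  also have "\<dots> = 2" by (subst infsum_add) (auto simp: pmf_summable_on infsum_pmf)
  finally show ?thesis by (simp add: infsum_cmult_right')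
qed

lemma hellinger_cut_and_paste:
  assumes "\<And>x. pmf P x * pmf Q x = pmf P' x * pmf Q' x"
  shows "hellinger P Q = hellinger P' Q'"
  by (simp add: hellinger_eq_affinity assms)

text \<open>Termwise AM-GM on \<open>p - q = (\<surd>p - \<surd>q) (\<surd>p + \<surd>q)\<close>.\<close>

lemma prob_diff_le_hellinger:
  assumes "t > 0"
  shows "measure_pmf.prob P S - measure_pmf.prob Q S \<le> 2 * t + hellinger P Q / (2 * t)"
proof -
  let ?d = "\<lambda>x. (sqrt (pmf P x) - sqrt (pmf Q x))\<^sup>2"
  have sm: "(\<lambda>x. t * (pmf P x + pmf Q x)) summable_on UNIV" "(\<lambda>x. ?d x / (2 * t)) summable_on UNIV"
    using summable_on_cmult_left[OF hellinger_summable[of P Q], of "1 / (2*t)"]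
    by (auto intro!: summable_on_cmult_right summable_on_add pmf_summable_on)
  have "measure_pmf.prob P S - measure_pmf.prob Q S = (\<Sum>\<^sub>\<infinity>x\<in>S. pmf P x - pmf Q x)"
    using infsum_add[OF pmf_summable_on[of P S] summable_on_uminus[THEN iffD2, OF pmf_summable_on[of Q S]]]
    by (simp add: infsum_pmf infsum_uminus)
  also have "\<dots> \<le> (\<Sum>\<^sub>\<infinity>x. t * (pmf P x + pmf Q x) + ?d x / (2 * t))"
  proof (rule infsum_mono_neutral)
    fix x
    define a b where "a = sqrt (pmf P x)" and "b = sqrt (pmf Q x)"
    have ab: "pmf P x = a\<^sup>2" "pmf Q x = b\<^sup>2" "0 \<le> a" "0 \<le> b" by (simp_all add: a_def b_def)
    \<comment> \<open>The second square turns \<open>(a + b)^2\<close> into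
      \<open>2 (a^2 + b^2)\<close>, which is linear in the two masses and sums to a
      constant.\<close>
    have "0 \<le> (t * (a + b) - (a - b))\<^sup>2 + t\<^sup>2 * (a - b)\<^sup>2" by simp
    also have "\<dots> = 2 * t * (t * (a\<^sup>2 + b\<^sup>2) + (a - b)\<^sup>2 / (2 * t) - (a\<^sup>2 - b\<^sup>2))"
      using assms by (simp add: field_simps power2_eq_square)
    finally show "pmf P x - pmf Q x \<le> t * (pmf P x + pmf Q x) + ?d x / (2 * t)"
      using assms by (simp add: ab zero_le_mult_iff)
  next
    show "(\<lambda>x. pmf P x - pmf Q x) summable_on S"
      using summable_on_add[OF pmf_summable_on[of P S] summable_on_uminus[THEN iffD2, OF pmf_summable_on[of Q S]]]
      by simp
  qed (use assms in \<open>auto intro!: summable_on_add sm\<close>)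
  also have "\<dots> = 2 * t + hellinger P Q / (2 * t)"
    unfolding hellinger_def
    by (subst infsum_add[OF sm])
      (simp add: infsum_cmult_right' infsum_add pmf_summable_on infsum_pmf
        infsum_cmult_left'[where c="1/(2*t)", simplified])
  finally show ?thesis .
qed

lemma hellinger_ge_prob_gap:
  assumes "\<delta> < 1/2" and "1 - \<delta> \<le> measure_pmf.prob P S" and "measure_pmf.prob Q S \<le> \<delta>"
  shows "(1 - 2 * \<delta>)\<^sup>2 / 4 \<le> hellinger P Q"
proof -
  define g where "g = 1 - 2 * \<delta>"
  have "g > 0" using assms by (simp add: g_def)
  have "g \<le> g / 2 + hellinger P Q / (g / 2)"
  proof -
    have "g \<le> measure_pmf.prob P S - measure_pmf.prob Q S" using assms by (simp add: g_def)
    \<comment> \<open>With \<open>t = g / 4\<close> the first term uses up exactly half of the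
      gap.\<close>
    then show ?thesis using prob_diff_le_hellinger[of "g / 4" P S Q] \<open>g > 0\<close> by simp
  qed
  then have "g / 2 * (g / 2) \<le> hellinger P Q"
    using \<open>g > 0\<close> by (simp add: field_simps)
  then show ?thesis by (simp add: g_def power2_eq_square)
qed

section \<open>Conditional mutual information and Hellinger distance\<close>

lemma distributed_map_pmf:
  "distributed (measure_pmf p) (count_space UNIV) f (\<lambda>x. ennreal (pmf (map_pmf f p) x))"
  unfolding distributed_def
  by (simp add: map_pmf_rep_eq[symmetric] measure_pmf_eq_density[symmetric])

section \<open>Integrability of the information density\<close>

lemma integrable_measure_pmf_iff:
  fixes f :: "'a \<Rightarrow> real"
  shows "integrable (measure_pmf p) f \<longleftrightarrow> integrable (count_space UNIV) (\<lambda>x. pmf p x * f x)"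
  by (subst measure_pmf_eq_density) (simp add: integrable_real_density)

lemma pmf_map_fst_ge: "pmf p (a, d) \<le> pmf (map_pmf fst p) a"
  by (subst pmf_map, subst measure_pmf_single[symmetric], rule measure_pmf.finite_measure_mono) auto

lemma pmf_map_snd_ge: "pmf p (a, d) \<le> pmf (map_pmf snd p) d"
  by (subst pmf_map, subst measure_pmf_single[symmetric], rule measure_pmf.finite_measure_mono) auto

text \<open>A majorant linear in \<open>y\<close>: the bound \<open>ln u <= u - 1\<close> at
  \<open>u\<close> and at \<open>1 / u\<close> controls both signs of the logarithm.\<close>

lemma pointwise_information_bound:
  fixes p x y :: real
  assumes "0 < p" "p \<le> x" "x \<le> 1" "p \<le> y"
  shows "\<bar>p * ln (p / (x * y))\<bar> \<le> y * (1 + 1 / x)"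
proof -
  have pos: "x > 0" "y > 0" using assms by auto
  have "p * ln (p / (x * y)) \<le> p * (p / (x * y))"
    using assms pos by (intro mult_left_mono order_trans[OF ln_le_minus_one]) auto
  also have "\<dots> = p * p / (x * y)" by simp
  also have "\<dots> \<le> y * y / (x * y)"
    using assms pos by (intro divide_right_mono mult_mono) auto
  also have "\<dots> = y * (1 / x)" using pos by (simp add: field_simps)
  finally have 1: "p * ln (p / (x * y)) \<le> y * (1 / x)" .
  have "- (p * ln (p / (x * y))) = p * ln (x * y / p)"
    using assms pos by (simp add: ln_div ln_mult algebra_simps)
  also have "\<dots> \<le> p * (x * y / p)"
    using assms pos by (intro mult_left_mono order_trans[OF ln_le_minus_one]) auto
  also have "\<dots> = x * y" using assms by simp
  also have "\<dots> \<le> y" using assms pos by (simp add: mult_left_le_one_le)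
  finally have 2: "- (p * ln (p / (x * y))) \<le> y" .
  have "0 \<le> y * (1 / x)" "0 \<le> y" using pos by auto
  then show ?thesis using 1 2 by (simp add: distrib_left abs_le_iff)
qed

text \<open>A Boolean first component has only two marginal masses, so the factor
  \<open>1 + 1 / x\<close> of the pointwise bound is at most a constant \<open>K\<close>, and the
  masses \<open>y d\<close> are summable. Where \<open>x a = 0\<close> the term itself
  vanishes.\<close>

lemma information_density_integrable:
  fixes p :: "(bool \<times> 'd) pmf"
  shows "integrable (count_space UNIV)
    (\<lambda>(a, d). pmf p (a, d) * log 2 (pmf p (a, d) / (pmf (map_pmf fst p) a * pmf (map_pmf snd p) d)))"
proof -
  define x where "x = pmf (map_pmf fst p)"
  define y where "y = pmf (map_pmf snd p)"
  define K where "K = 1 + 1 / x True + 1 / x False"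
  have y0: "0 \<le> y d" for d by (simp add: y_def)
  have x01: "0 \<le> x a" "x a \<le> 1" for a by (simp_all add: x_def pmf_le_1)
  \<comment> \<open>The fair coin makes the majorant a multiple of a pmf on pairs; the factor 2
    cancels its \<open>1/2\<close>.\<close>
  have "integrable (count_space UNIV)
      (\<lambda>s. (2 * K / ln 2) * pmf (pair_pmf (bernoulli_pmf (1/2)) (map_pmf snd p)) s)"
    by (intro integrable_mult_right integrable_pmf)
  then show ?thesis
  proof (rule Bochner_Integration.integrable_bound)
    show "AE s in count_space UNIV. norm (case s of (a, d) \<Rightarrow> pmf p (a, d) *
        log 2 (pmf p (a, d) / (pmf (map_pmf fst p) a * pmf (map_pmf snd p) d)))
      \<le> norm ((2 * K / ln 2) * pmf (pair_pmf (bernoulli_pmf (1/2)) (map_pmf snd p)) s)"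
    proof (rule AE_I2, clarify)
      fix a d
      have K: "1 + 1 / x a \<le> K" "K \<ge> 0" using x01[of True] x01[of False] by (cases a; simp add: K_def)+
      have half: "pmf (bernoulli_pmf (1/2)) a = 1/2" by (cases a) auto
      have "\<bar>pmf p (a, d) * ln (pmf p (a, d) / (x a * y d))\<bar> \<le> y d * K"
      proof (cases "pmf p (a, d) = 0")
        case False
        then have "\<bar>pmf p (a, d) * ln (pmf p (a, d) / (x a * y d))\<bar> \<le> y d * (1 + 1 / x a)"
          by (intro pointwise_information_bound)
            (auto simp: x_def y_def pmf_map_fst_ge pmf_map_snd_ge pmf_le_1 pmf_pos)
        also have "\<dots> \<le> y d * K" using K by (intro mult_left_mono) (auto simp: y_def)
        finally show ?thesis .
      qed (simp add: K y_def)
      then have "\<bar>pmf p (a, d) * ln (pmf p (a, d) / (x a * y d))\<bar> / ln 2 \<le> y d * K / ln 2"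
        by (intro divide_right_mono) auto
      then show "norm (pmf p (a, d) *
          log 2 (pmf p (a, d) / (pmf (map_pmf fst p) a * pmf (map_pmf snd p) d)))
        \<le> norm ((2 * K / ln 2) * pmf (pair_pmf (bernoulli_pmf (1/2)) (map_pmf snd p)) (a, d))"
        using K y0[of d] unfolding x_def[symmetric] y_def[symmetric] pmf_pair half
        by (simp add: log_def abs_mult mult.commute)
    qed
  qed simp
qed

text \<open>Applying \<open>ln u <= u - 1\<close> to \<open>u = sqrt (r / p)\<close> instead of
  \<open>r / p\<close> keeps the cross term \<open>sqrt p * sqrt r\<close>, hence the Hellinger
  term.\<close>

lemma mult_log_ge_hellinger:
  fixes p r :: real
  assumes "0 \<le> p" "0 \<le> r" "p > 0 \<Longrightarrow> r > 0"
  shows "((sqrt p - sqrt r)\<^sup>2 + p - r) / ln 2 \<le> p * log 2 (p / r)"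
proof (cases "p = 0")
  case False
  then have pr: "p > 0" "r > 0" using assms by auto
  have "p * ln (r / p) = 2 * p * ln (sqrt (r / p))" using pr by (simp add: ln_sqrt)
  also have "\<dots> \<le> 2 * p * (sqrt (r / p) - 1)"
    using pr by (intro mult_left_mono ln_le_minus_one) auto
  also have "\<dots> = 2 * (sqrt p * sqrt r) - 2 * p"
    using pr by (simp add: real_sqrt_divide algebra_simps) (simp add: field_simps)
  finally have "(sqrt p - sqrt r)\<^sup>2 + p - r \<le> p * ln (p / r)"
    using pr by (simp add: power2_diff ln_div algebra_simps)
  then show ?thesis by (simp add: log_def divide_right_mono)
qed (use assms in \<open>simp add: power2_eq_square\<close>)

lemma infsum_bool_prod:
  fixes f :: "bool \<times> 'd \<Rightarrow> real"
  assumes "f summable_on UNIV"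
  shows "(\<lambda>d. f (a, d)) summable_on UNIV"
    and "infsum f UNIV = (\<Sum>\<^sub>\<infinity>d. f (True, d) + f (False, d))"
proof -
  have f: "f summable_on (Sigma UNIV (\<lambda>_. UNIV))" using assms by simp
  have 1: "(\<lambda>d. f (a, d)) summable_on UNIV" for a
    by (rule summable_on_SigmaD1[where f="\<lambda>a d. f (a, d)" and A=UNIV]) (use f in simp_all)
  show "(\<lambda>d. f (a, d)) summable_on UNIV" by (rule 1)
  show "infsum f UNIV = (\<Sum>\<^sub>\<infinity>d. f (True, d) + f (False, d))"
  proof -
    have "infsum f UNIV = (\<Sum>a\<in>UNIV. \<Sum>\<^sub>\<infinity>d. f (a, d))" using infsum_Sigma_banach[OF f] by simp
    then show ?thesis by (simp add: UNIV_bool infsum_add[OF 1 1])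
  qed
qed

text \<open>Chain rule at the level of densities: the integrand is the density of
  \<open>I(A : B, C)\<close> minus that of \<open>I(A : C)\<close>. Both are integrable because
  \<open>A\<close> is Boolean, so the integral is a genuine unordered sum.\<close>

lemma cond_mutual_info_eq_infsum:
  fixes p :: "'s pmf" and A :: "'s \<Rightarrow> bool" and B :: "'s \<Rightarrow> 'b::countable" and C :: "'s \<Rightarrow> 'c::countable"
  defines "g \<equiv> \<lambda>(a, b, c). pmf (map_pmf (\<lambda>s. (A s, B s, C s)) p) (a, b, c) *
    log 2 (pmf (map_pmf (\<lambda>s. (A s, B s, C s)) p) (a, b, c) /
      (pmf (map_pmf (\<lambda>s. (A s, C s)) p) (a, c) *
        (pmf (map_pmf (\<lambda>s. (B s, C s)) p) (b, c) / pmf (map_pmf C p) c)))"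
  shows "g summable_on UNIV" and "cond_mutual_info p A B C = infsum g UNIV"
proof -
  interpret information_space "measure_pmf p" 2 by unfold_locales simp
  let ?xyz = "map_pmf (\<lambda>s. (A s, B s, C s)) p" and ?xz = "map_pmf (\<lambda>s. (A s, C s)) p"
    and ?yz = "map_pmf (\<lambda>s. (B s, C s)) p" and ?x = "map_pmf A p" and ?z = "map_pmf C p"
  have mapsimps: "map_pmf fst ?xyz = ?x" "map_pmf snd ?xyz = ?yz" "map_pmf fst ?xz = ?x" "map_pmf snd ?xz = ?z"
    "map_pmf (\<lambda>(a, b, c). (a, c)) ?xyz = ?xz"
    by (simp_all add: pmf.map_comp comp_def)
  let ?i1 = "\<lambda>(a, b, c). pmf ?xyz (a, b, c) * log 2 (pmf ?xyz (a, b, c) / (pmf ?x a * pmf ?yz (b, c)))"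
  let ?i2 = "\<lambda>(a, b, c). pmf ?xyz (a, b, c) * log 2 (pmf ?xz (a, c) / (pmf ?x a * pmf ?z c))"
  have I1: "integrable (count_space UNIV) ?i1"
    using information_density_integrable[of ?xyz] unfolding mapsimps
    by (simp add: case_prod_unfold)
  have "integrable (measure_pmf ?xz) (\<lambda>(a, c). log 2 (pmf ?xz (a, c) / (pmf ?x a * pmf ?z c)))"
    using information_density_integrable[of ?xz] unfolding mapsimps integrable_measure_pmf_iff
    by (simp add: case_prod_unfold)
  \<comment> \<open>The second density ignores \<open>b\<close>, so its integrability transfers from
    the law of \<open>(A, C)\<close> to that of \<open>(A, B, C)\<close>.\<close>
  then have "integrable (measure_pmf ?xyz) (\<lambda>(a, b, c). log 2 (pmf ?xz (a, c) / (pmf ?x a * pmf ?z c)))"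
    unfolding mapsimps(5)[symmetric] map_pmf_rep_eq[of "\<lambda>(a, b, c). (a, c)"]
    by (subst (asm) integrable_distr_eq) (auto simp: case_prod_unfold mapsimps)
  then have I2: "integrable (count_space UNIV) ?i2"
    unfolding integrable_measure_pmf_iff by (simp add: case_prod_unfold)
  have eq: "cond_mutual_info p A B C = integral\<^sup>L (count_space UNIV) g"
    unfolding cond_mutual_info_def g_def
    by (subst conditional_mutual_information_generic_eq[where Px="pmf ?x" and Pz="pmf ?z" and Pyz="pmf ?yz"
          and Pxz="pmf ?xz" and Pxyz="pmf ?xyz"])
      (use I1 I2 in \<open>simp_all add: pair_measure_countable distributed_map_pmf sigma_finite_measure_count_space\<close>)
  have pos: "pmf ?xz (a, c) > 0 \<and> pmf ?yz (b, c) > 0 \<and> pmf ?x a > 0 \<and> pmf ?z c > 0"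
    if "pmf ?xyz (a, b, c) > 0" for a b c
    using that by (auto simp: pmf_positive_iff set_map_pmf)
  have "g s = ?i1 s - ?i2 s" for s
  proof (cases s)
    case (fields a b c)
    show ?thesis
    proof (cases "pmf ?xyz (a, b, c) = 0")
      case False
      then have *: "pmf ?xyz (a, b, c) > 0" by (simp add: pmf_pos)
      with pos[OF *] show ?thesis
        by (simp add: g_def fields log_divide log_mult algebra_simps)
    qed (simp add: g_def fields)
  qed
  then have g: "g = (\<lambda>s. ?i1 s - ?i2 s)" by auto
  have "integrable (count_space UNIV) g"
    unfolding g by (rule Bochner_Integration.integrable_diff[OF I1 I2])
  then have abs: "Infinite_Set_Sum.abs_summable_on g UNIV"
    by (simp add: Infinite_Set_Sum.abs_summable_on_def)
  show "g summable_on UNIV"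
    using abs abs_summable_equivalent abs_summable_summable by blast
  show "cond_mutual_info p A B C = infsum g UNIV"
    unfolding eq using infsetsum_infsum[OF abs] by (simp add: infsetsum_def)
qed


section \<open>Hellinger distance of conditional laws bounded by information\<close>

lemma pmf_map_bool_marginal:
  "pmf (map_pmf (\<lambda>s. (A s, f s)) p) (True, w) + pmf (map_pmf (\<lambda>s. (A s, f s)) p) (False, w)
    = pmf (map_pmf f p) w"
  unfolding pmf_map
  by (subst measure_pmf.finite_measure_Union[symmetric]) (auto intro!: arg_cong[of _ _ "measure_pmf.prob p"])

text \<open>
  Comparing \<open>J(a, b, c)\<close> with \<open>r = J(a, c) J(b, c) / J(c)\<close> term by term, the linear terms \<open>J - r\<close> of
  the bound \<open>mult_log_ge_hellinger\<close> cancel after summing over the two values of \<open>a\<close> alone; where \<open>a\<close> is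
  uniform given \<open>c\<close>, \<open>r\<close> does not depend on \<open>a\<close>.
\<close>

lemma cond_mutual_info_ge_hellinger:
  fixes p :: "'s pmf" and A :: "'s \<Rightarrow> bool" and B :: "'s \<Rightarrow> 'b::countable" and C :: "'s \<Rightarrow> 'c::countable"
  defines "J \<equiv> pmf (map_pmf (\<lambda>s. (A s, B s, C s)) p)"
  assumes "finite F"
    and balanced: "\<And>c. c \<in> F \<Longrightarrow>
      pmf (map_pmf (\<lambda>s. (A s, C s)) p) (True, c) = pmf (map_pmf (\<lambda>s. (A s, C s)) p) (False, c)"
  shows "(\<Sum>c\<in>F. \<Sum>\<^sub>\<infinity>b. (sqrt (J (True, b, c)) - sqrt (J (False, b, c)))\<^sup>2) \<le> 2 * cond_mutual_info p A B C"
proof -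
  define y where "y = pmf (map_pmf (\<lambda>s. (B s, C s)) p)"
  define u where "u = pmf (map_pmf (\<lambda>s. (A s, C s)) p)"
  define z where "z = pmf (map_pmf C p)"
  define r where "r = (\<lambda>(a, b, c). u (a, c) * (y (b, c) / z c))"
  define g where "g = (\<lambda>(a, b, c). J (a, b, c) * log 2 (J (a, b, c) / r (a, b, c)))"
  define h where "h = (\<lambda>(b, c). (sqrt (J (True, b, c)) - sqrt (J (False, b, c)))\<^sup>2)"
  have g: "g summable_on UNIV" "cond_mutual_info p A B C = infsum g UNIV"
    using cond_mutual_info_eq_infsum[where p=p and A=A and B=B and C=C] by (simp_all add: g_def r_def u_def y_def z_def J_def)
  define G where "G = (\<lambda>d. g (True, d) + g (False, d))"
  have G: "G summable_on UNIV" "cond_mutual_info p A B C = infsum G UNIV"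
    unfolding G_def g(2) by (auto intro!: summable_on_add infsum_bool_prod g(1))
  have nn: "0 \<le> J s" "0 \<le> r s" for s by (auto simp: J_def r_def u_def y_def z_def split: prod.split)
  have pos: "0 < r (a, b, c)" if "0 < J (a, b, c)" for a b c
    using that by (auto simp: r_def J_def u_def y_def z_def pmf_positive_iff intro!: mult_pos_pos divide_pos_pos)
  have marg: "J (True, b, c) + J (False, b, c) = y (b, c)" "u (True, c) + u (False, c) = z c" for b c
    unfolding J_def y_def u_def z_def by (rule pmf_map_bool_marginal)+
  have r_marg: "r (True, b, c) + r (False, b, c) = y (b, c)" for b c
  proof (cases "z c = 0")
    case True
    then have "y (b, c) = 0"
      by (auto simp: z_def y_def pmf_eq_0_set_pmf)
    then show ?thesis by (simp add: r_def)
  next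
    case False
    have "r (True, b, c) + r (False, b, c) = (u (True, c) + u (False, c)) * (y (b, c) / z c)"
      by (simp add: r_def distrib_right add_divide_distrib)
    then show ?thesis using False by (simp add: marg)
  qed
  have Gge: "(sqrt (J (True, b, c)) - sqrt (r (True, b, c)))\<^sup>2 + (sqrt (J (False, b, c)) - sqrt (r (False, b, c)))\<^sup>2
      \<le> G (b, c)" (is "?D \<le> _") for b c
  proof -
    have "?D = ((sqrt (J (True, b, c)) - sqrt (r (True, b, c)))\<^sup>2 + J (True, b, c) - r (True, b, c))
        + ((sqrt (J (False, b, c)) - sqrt (r (False, b, c)))\<^sup>2 + J (False, b, c) - r (False, b, c))"
      using marg(1)[of b c] r_marg[of b c] by linarith
    also have "\<dots> / ln 2 \<le> G (b, c)"
      unfolding G_def g_def add_divide_distrib[of "_ - _" "_ - _"] prod.case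
      by (intro add_mono mult_log_ge_hellinger nn pos)
    finally have "?D / ln 2 \<le> G (b, c)" .
    \<comment> \<open>Since \<open>ln 2 < 1\<close>, the change to bits only helps.\<close>
    moreover have "?D \<le> ?D / ln 2" using ln_2_less_1 by (simp add: pos_le_divide_eq mult_left_le)
    ultimately show ?thesis by linarith
  qed
  \<comment> \<open>Nonnegativity off \<open>F\<close> allows the sum over \<open>F\<close> to be
    bounded by the sum over all conditioning values.\<close>
  have G0: "0 \<le> G d" for d using Gge[of "fst d" "snd d"]
    by (smt (verit) prod.collapse zero_le_power2)
  have hG: "h (b, c) \<le> 2 * G (b, c)" if "c \<in> F" for b c
  proof -
    have "r (True, b, c) = r (False, b, c)" using balanced[OF that] by (simp add: r_def u_def)
    \<comment> \<open>Here \<open>q\<close> is the common root of the two reference masses; both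
      conditional laws are compared through it.\<close>
    moreover have "(s - t)\<^sup>2 \<le> 2 * ((s - q)\<^sup>2 + (t - q)\<^sup>2)" for s t q :: real
    proof -
      have "0 \<le> (s + t - 2 * q)\<^sup>2" by simp
      then show ?thesis by (simp add: power2_eq_square algebra_simps)
    qed
    ultimately have "h (b, c) \<le> 2 * ((sqrt (J (True, b, c)) - sqrt (r (True, b, c)))\<^sup>2
        + (sqrt (J (False, b, c)) - sqrt (r (False, b, c)))\<^sup>2)"
      by (simp add: h_def)
    also have "\<dots> \<le> 2 * G (b, c)" by (intro mult_left_mono Gge) simp
    finally show ?thesis .
  qed
  have hs: "(\<lambda>b. h (b, c)) summable_on UNIV" if "c \<in> F" for c
  proof (rule summable_on_comparison_test)
    have "(\<lambda>d. 2 * G d) summable_on (\<lambda>b. (b, c)) ` UNIV"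
      by (intro summable_on_cmult_right summable_on_subset_banach[OF G(1)]) simp
    then show "(\<lambda>b. 2 * G (b, c)) summable_on UNIV"
      by (subst (asm) summable_on_reindex) (auto simp: inj_on_def comp_def)
  qed (auto simp: hG[OF that], simp add: h_def)
  have "(\<Sum>c\<in>F. \<Sum>\<^sub>\<infinity>b. h (b, c)) \<le> infsum (\<lambda>d. 2 * G d) UNIV"
  proof -
    have "(\<Sum>c\<in>F. \<Sum>\<^sub>\<infinity>b. h (b, c)) = (\<Sum>c\<in>F. infsum h ((\<lambda>b. (b, c)) ` UNIV))"
      by (intro sum.cong refl) (subst infsum_reindex, auto simp: inj_on_def comp_def)
    also have "\<dots> = infsum h (\<Union>c\<in>F. (\<lambda>b. (b, c)) ` UNIV)"
      by (rule sum_infsum[OF \<open>finite F\<close>])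
        (use hs in \<open>auto simp: summable_on_reindex inj_on_def comp_def\<close>)
    also have "\<dots> \<le> infsum (\<lambda>d. 2 * G d) UNIV"
    proof (rule infsum_mono_neutral)
      show "h summable_on (\<Union>c\<in>F. (\<lambda>b. (b, c)) ` UNIV)"
        by (rule summable_on_comparison_test[OF summable_on_subset_banach[of _ UNIV, OF summable_on_cmult_right[OF G(1), of 2]]])
          (auto simp: hG, simp add: h_def)
    qed (auto intro!: summable_on_cmult_right G hG simp: G0)
    finally show ?thesis .
  qed
  then show ?thesis by (simp add: h_def G(2) infsum_cmult_right')
qed

lemma pmf_map_eq_infsum:
  "pmf (map_pmf (\<lambda>s. (A s, C s)) p) (a, c) = (\<Sum>\<^sub>\<infinity>b. pmf (map_pmf (\<lambda>s. (A s, B s, C s)) p) (a, b, c))"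
proof -
  let ?Q = "map_pmf (\<lambda>s. (A s, B s, C s)) p"
  have "pmf (map_pmf (\<lambda>s. (A s, C s)) p) (a, c) = measure_pmf.prob ?Q (range (\<lambda>b. (a, b, c)))"
    unfolding pmf_map measure_map_pmf by (rule arg_cong[of _ _ "measure_pmf.prob p"]) auto
  also have "\<dots> = (\<Sum>\<^sub>\<infinity>b. pmf ?Q (a, b, c))"
    by (subst infsum_pmf[symmetric], subst infsum_reindex) (auto simp: inj_on_def comp_def)
  finally show ?thesis .
qed

text \<open>\<open>V a t\<close> is the law of \<open>B\<close> given \<open>A = a\<close> and
  \<open>C = \<iota> t\<close> where \<open>\<alpha> t > 0\<close>. The weight does not depend on
  \<open>a\<close>, so \<open>A\<close> is uniform given such a value of \<open>C\<close>.\<close>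

lemma cond_mutual_info_ge_mixture:
  fixes p :: "'s pmf" and A :: "'s \<Rightarrow> bool" and B :: "'s \<Rightarrow> 'b::countable" and C :: "'s \<Rightarrow> 'c::countable"
  assumes "finite T" and "inj_on \<iota> T" and "\<And>t. t \<in> T \<Longrightarrow> 0 \<le> \<alpha> t"
    and J: "\<And>a b t. t \<in> T \<Longrightarrow> pmf (map_pmf (\<lambda>s. (A s, B s, C s)) p) (a, b, \<iota> t) = \<alpha> t * pmf (V a t) b"
  shows "(\<Sum>t\<in>T. \<alpha> t * hellinger (V True t) (V False t)) \<le> 2 * cond_mutual_info p A B C"
proof -
  let ?J = "pmf (map_pmf (\<lambda>s. (A s, B s, C s)) p)"
  have bal: "pmf (map_pmf (\<lambda>s. (A s, C s)) p) (a, \<iota> t) = \<alpha> t" if "t \<in> T" for a t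
    by (simp add: pmf_map_eq_infsum[of A C p a "\<iota> t" B] J[OF that] infsum_cmult_right' infsum_pmf)
  have "(\<Sum>t\<in>T. \<alpha> t * hellinger (V True t) (V False t)) =
      (\<Sum>t\<in>T. \<Sum>\<^sub>\<infinity>b. (sqrt (?J (True, b, \<iota> t)) - sqrt (?J (False, b, \<iota> t)))\<^sup>2)"
  proof (rule sum.cong[OF refl])
    fix t assume t: "t \<in> T"
    have "(sqrt (?J (True, b, \<iota> t)) - sqrt (?J (False, b, \<iota> t)))\<^sup>2
        = \<alpha> t * (sqrt (pmf (V True t) b) - sqrt (pmf (V False t) b))\<^sup>2" for b
      using assms(3)[OF t]
      by (simp add: J[OF t] real_sqrt_mult right_diff_distrib[symmetric] power_mult_distrib)
    then show "\<alpha> t * hellinger (V True t) (V False t) =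
      (\<Sum>\<^sub>\<infinity>b. (sqrt (?J (True, b, \<iota> t)) - sqrt (?J (False, b, \<iota> t)))\<^sup>2)"
      by (simp add: hellinger_def infsum_cmult_right')
  qed
  also have "\<dots> = (\<Sum>c\<in>\<iota> ` T. \<Sum>\<^sub>\<infinity>b. (sqrt (?J (True, b, c)) - sqrt (?J (False, b, c)))\<^sup>2)"
    by (simp add: sum.reindex[OF assms(2)] comp_def)
  also have "\<dots> \<le> 2 * cond_mutual_info p A B C"
    by (rule cond_mutual_info_ge_hellinger) (use assms(1) bal in auto)
  finally show ?thesis .
qed

section \<open>Product structure of transcripts\<close>

text \<open>Tests coins against a fixed view instead of an execution, so that the condition involves
  the coins and row of one processor only.\<close>

definition consistent :: "protocol \<Rightarrow> nat \<Rightarrow> nat \<Rightarrow> bool \<times> bool \<Rightarrow> view \<Rightarrow> bool" where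
  "consistent P i c x v \<longleftrightarrow> (\<forall>n<length v. snd (v ! n) = answer P i c x (take n v) (fst (v ! n)))"

definition coord_consistent :: "protocol \<Rightarrow> nat \<Rightarrow> transcript \<Rightarrow> bool" where
  "coord_consistent P r \<tau> \<longleftrightarrow>
    (\<forall>n<length \<tau>. coord P r (take n \<tau>) = Send (fst (\<tau> ! n)) (fst (snd (\<tau> ! n))))"

definition valid :: "protocol \<Rightarrow> coins \<Rightarrow> matrix \<Rightarrow> transcript \<Rightarrow> bool" where
  "valid P \<rho> X \<tau> \<longleftrightarrow> coord_consistent P (fst \<rho>) \<tau> \<and>
    (\<forall>i. consistent P i (snd \<rho> i) (X i) (view_of i \<tau>))"

lemma consistent_Nil [simp]: "consistent P i c x []"
  by (simp add: consistent_def)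

lemma coord_consistent_Nil [simp]: "coord_consistent P r []"
  by (simp add: coord_consistent_def)

lemma consistent_snoc [simp]:
  "consistent P i c x (v @ [e]) \<longleftrightarrow> consistent P i c x v \<and> snd e = answer P i c x v (fst e)"
  by (auto simp: consistent_def less_Suc_eq nth_append)

lemma coord_consistent_snoc [simp]:
  "coord_consistent P r (\<tau> @ [e]) \<longleftrightarrow>
    coord_consistent P r \<tau> \<and> coord P r \<tau> = Send (fst e) (fst (snd e))"
  by (auto simp: coord_consistent_def less_Suc_eq nth_append)

lemma view_of_Nil [simp]: "view_of i [] = []"
  by (simp add: view_of_def)

lemma view_of_snoc [simp]:
  "view_of i (\<tau> @ [e]) = (if fst e = i then view_of i \<tau> @ [snd e] else view_of i \<tau>)"
  by (simp add: view_of_def)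

lemma valid_snoc_iff:
  "valid P \<rho> X (\<tau> @ [e]) \<longleftrightarrow> valid P \<rho> X \<tau> \<and> running P \<rho> \<tau> \<and> step P \<rho> X \<tau> = \<tau> @ [e]"
proof (cases e)
  case (fields j m a)
  show ?thesis
    by (cases "coord P (fst \<rho>) \<tau>") (auto simp: valid_def running_def step_def fields)
qed

text \<open>A valid transcript is a state the loop passes through, because each of its entries is
  the step forced by the coins and the input.\<close>

lemma while_option_valid:
  "valid P \<rho> X \<tau> \<Longrightarrow>
    while_option (running P \<rho>) (step P \<rho> X) [] = while_option (running P \<rho>) (step P \<rho> X) \<tau>"
proof (induction \<tau> rule: rev_induct)
  case (snoc e \<tau>)
  then have "valid P \<rho> X \<tau>" and r: "running P \<rho> \<tau>" and s: "step P \<rho> X \<tau> = \<tau> @ [e]"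
    by (simp_all add: valid_snoc_iff)
  then show ?case
    using snoc.IH while_option_unfold[of "running P \<rho>" "step P \<rho> X" \<tau>] by simp
qed simp

text \<open>Replaces the loop by a conjunction of conditions on the coins of separate
  parties.\<close>

lemma run_eq_Some_iff: "run P \<rho> X = Some \<tau> \<longleftrightarrow> valid P \<rho> X \<tau> \<and> \<not> running P \<rho> \<tau>"
proof
  assume *: "run P \<rho> X = Some \<tau>"
  have "valid P \<rho> X \<tau>"
  proof (rule while_option_rule[OF _ *[unfolded run_def]])
    fix s assume "valid P \<rho> X s" "running P \<rho> s"
    moreover from \<open>running P \<rho> s\<close> obtain e where "step P \<rho> X s = s @ [e]"
      by (auto simp: running_def step_def)
    ultimately show "valid P \<rho> X (step P \<rho> X s)" by (simp add: valid_snoc_iff)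
  qed (simp add: valid_def)
  then show "valid P \<rho> X \<tau> \<and> \<not> running P \<rho> \<tau>"
    using while_option_stop[OF *[unfolded run_def]] by simp
next
  assume "valid P \<rho> X \<tau> \<and> \<not> running P \<rho> \<tau>"
  then show "run P \<rho> X = Some \<tau>"
    using while_option_valid[of P \<rho> X \<tau>] while_option_unfold[of "running P \<rho>" "step P \<rho> X" \<tau>]
    by (simp add: run_def)
qed

lemma coord_consistent_view_Nil:
  assumes "is_protocol k P" and "coord_consistent P r \<tau>" and "i \<ge> k"
  shows "view_of i \<tau> = []"
  using assms(2)
proof (induction \<tau> rule: rev_induct)
  case (snoc e \<tau>)
  then have "coord P r \<tau> = Send (fst e) (fst (snd e))" by simp
  then have "fst e < k" using assms(1) unfolding is_protocol_def by blast
  then show ?case using snoc assms(3) by simp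
qed simp

section \<open>Product form of the law of outcomes\<close>

text \<open>The output of the protocol is a function of an outcome, so the coordinator's coins are kept.\<close>

definition outcome :: "nat \<Rightarrow> protocol \<Rightarrow> matrix \<Rightarrow> (nat \<times> transcript) pmf" where
  "outcome k P X = map_pmf (\<lambda>\<rho>. (fst \<rho>, full_transcript P \<rho> X)) (coins_pmf k P)"

definition view_pmf :: "nat \<Rightarrow> protocol \<Rightarrow> nat \<Rightarrow> matrix \<Rightarrow> view pmf" where
  "view_pmf k P i X = map_pmf (\<lambda>\<rho>. view_of i (full_transcript P \<rho> X)) (coins_pmf k P)"

definition answer_prob :: "protocol \<Rightarrow> nat \<Rightarrow> bool \<times> bool \<Rightarrow> view \<Rightarrow> real" where
  "answer_prob P i x v = measure_pmf.prob (proc_coins P i) {c. consistent P i c x v}"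

text \<open>The halting condition gives weight zero to unfinished transcripts.\<close>

definition coord_prob :: "protocol \<Rightarrow> nat \<times> transcript \<Rightarrow> real" where
  "coord_prob P = (\<lambda>(r, \<tau>).
    if coord_consistent P r \<tau> \<and> (\<nexists>i m. coord P r \<tau> = Send i m) then pmf (coord_coins P) r else 0)"

lemma answer_prob_nonneg: "0 \<le> answer_prob P i x v"
  by (simp add: answer_prob_def)

lemma coord_prob_nonneg: "0 \<le> coord_prob P s"
  by (simp add: coord_prob_def split: prod.split)

text \<open>The coins leading to a given outcome form a rectangle, and the parties draw their coins
  independently.\<close>

lemma pmf_outcome:
  assumes "is_protocol k P"
  shows "pmf (outcome k P X) s =
    coord_prob P s * (\<Prod>i<k. answer_prob P i (X i) (view_of i (snd s)))"
proof (cases s)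
  case (Pair r \<tau>)
  define A where
    "A = (if coord_consistent P r \<tau> \<and> (\<nexists>i m. coord P r \<tau> = Send i m) then {r} else {})"
  define B where "B = Pi {..<k} (\<lambda>i. {c. consistent P i c (X i) (view_of i \<tau>)})"
  let ?N = "Pi_pmf {..<k} 0 (proc_coins P)"
  have iff: "(fst \<rho>, full_transcript P \<rho> X) = (r, \<tau>) \<longleftrightarrow> fst \<rho> \<in> A \<and> snd \<rho> \<in> B"
    if "\<rho> \<in> set_pmf (coins_pmf k P)" for \<rho>
  proof -
    have "run P \<rho> X \<noteq> None" using assms that unfolding is_protocol_def by blast
    then have "full_transcript P \<rho> X = \<tau> \<longleftrightarrow> run P \<rho> X = Some \<tau>"
      by (auto simp: full_transcript_def)
    also have "\<dots> \<longleftrightarrow> coord_consistent P (fst \<rho>) \<tau> \<and> snd \<rho> \<in> B \<and> \<not> running P \<rho> \<tau>"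
      using coord_consistent_view_Nil[OF assms, of "fst \<rho>" \<tau>]
      by (auto simp: run_eq_Some_iff valid_def B_def Pi_def) (metis consistent_Nil not_less)
    finally show ?thesis by (auto simp: A_def running_def)
  qed
  have "pmf (outcome k P X) s = measure_pmf.prob (coins_pmf k P) ((\<lambda>\<rho>. (fst \<rho>, full_transcript P \<rho> X)) -` {s})"
    by (simp add: outcome_def pmf_map)
  \<comment> \<open>Coin vectors form an uncountable type; intersecting with the support makes the
    set countable, as the product rule requires.\<close>
  also have "\<dots> = measure_pmf.prob (coins_pmf k P) (A \<times> (B \<inter> set_pmf ?N))"
    by (intro measure_pmf.finite_measure_eq_AE AE_pmfI)
      (use iff in \<open>auto simp: Pair coins_pmf_def\<close>)
  also have "\<dots> = measure_pmf.prob (coord_coins P) A * measure_pmf.prob ?N B"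
    unfolding coins_pmf_def
    by (subst measure_pmf_prob_product)
      (auto simp: measure_Int_set_pmf A_def intro: countable_subset[OF Int_lower2])
  also have "measure_pmf.prob ?N B = (\<Prod>i<k. answer_prob P i (X i) (view_of i \<tau>))"
    by (simp add: B_def measure_Pi_pmf_Pi answer_prob_def)
  also have "measure_pmf.prob (coord_coins P) A = coord_prob P s"
    by (auto simp: A_def coord_prob_def Pair measure_pmf_single)
  finally show ?thesis by (simp add: Pair)
qed

definition others_prob :: "nat \<Rightarrow> protocol \<Rightarrow> nat \<Rightarrow> matrix \<Rightarrow> nat \<times> transcript \<Rightarrow> real" where
  "others_prob k P i X s =
    coord_prob P s * (\<Prod>j\<in>{..<k} - {i}. answer_prob P j (X j) (view_of j (snd s)))"

lemma pmf_outcome_split: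
  assumes "is_protocol k P" and "i < k"
  shows "pmf (outcome k P X) s = answer_prob P i (X i) (view_of i (snd s)) * others_prob k P i X s"
  using assms by (simp add: pmf_outcome others_prob_def prod.remove[of "{..<k}" i])

lemma others_prob_nonneg: "0 \<le> others_prob k P i X s"
  by (simp add: others_prob_def coord_prob_nonneg answer_prob_nonneg prod_nonneg)

lemma others_prob_cong:
  assumes "\<And>j. j < k \<Longrightarrow> j \<noteq> i \<Longrightarrow> X j = Y j"
  shows "others_prob k P i X = others_prob k P i Y"
  using assms by (auto simp: others_prob_def fun_eq_iff intro!: arg_cong2[of _ _ _ _ "(*)"] prod.cong)

lemma outcome_cong:
  assumes "is_protocol k P" and "\<And>j. j < k \<Longrightarrow> X j = Y j"
  shows "outcome k P X = outcome k P Y"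
  using assms by (intro pmf_eqI) (simp add: pmf_outcome)

lemma view_pmf_eq_map_outcome: "view_pmf k P i X = map_pmf (\<lambda>s. view_of i (snd s)) (outcome k P X)"
  by (simp add: view_pmf_def outcome_def pmf.map_comp comp_def)

definition others_view_prob :: "nat \<Rightarrow> protocol \<Rightarrow> nat \<Rightarrow> matrix \<Rightarrow> view \<Rightarrow> real" where
  "others_view_prob k P i X v = infsum (others_prob k P i X) {s. view_of i (snd s) = v}"

lemma others_view_prob_cong:
  assumes "\<And>j. j < k \<Longrightarrow> j \<noteq> i \<Longrightarrow> X j = Y j"
  shows "others_view_prob k P i X = others_view_prob k P i Y"
  unfolding others_view_prob_def by (subst others_prob_cong[of k i X Y]) (simp_all add: assms)

text \<open>The factor of processor \<open>i\<close> is constant on the outcomes with a given view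
  of \<open>i\<close>, so the product form survives the passage to views.\<close>

lemma pmf_view_pmf:
  assumes "is_protocol k P" and "i < k"
  shows "pmf (view_pmf k P i X) v = answer_prob P i (X i) v * others_view_prob k P i X v"
proof -
  have "pmf (view_pmf k P i X) v = infsum (pmf (outcome k P X)) {s. view_of i (snd s) = v}"
    by (simp add: view_pmf_eq_map_outcome pmf_map infsum_pmf vimage_def)
  also have "\<dots> = (\<Sum>\<^sub>\<infinity>s\<in>{s. view_of i (snd s) = v}. answer_prob P i (X i) v * others_prob k P i X s)"
    by (intro infsum_cong) (simp add: pmf_outcome_split[OF assms])
  finally show ?thesis by (simp add: infsum_cmult_right' others_view_prob_def)
qed

text \<open>The view of \<open>i\<close> is a sufficient statistic for its row: the factor of the
  other parties is common to both densities and comes out of the squared difference. Summing it over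
  the outcomes with a given view leaves the law of the view.\<close>

lemma hellinger_outcome_eq_view:
  assumes P: "is_protocol k P" and i: "i < k" and eq: "\<And>j. j < k \<Longrightarrow> j \<noteq> i \<Longrightarrow> X j = Y j"
  shows "hellinger (outcome k P X) (outcome k P Y) = hellinger (view_pmf k P i X) (view_pmf k P i Y)"
proof -
  let ?d = "\<lambda>s. (sqrt (pmf (outcome k P X) s) - sqrt (pmf (outcome k P Y) s))\<^sup>2"
  let ?v = "\<lambda>s::nat \<times> transcript. view_of i (snd s)"
  let ?a = "\<lambda>v. (sqrt (answer_prob P i (X i) v) - sqrt (answer_prob P i (Y i) v))\<^sup>2"
  have split: "(sqrt (a * c) - sqrt (b * c))\<^sup>2 = (sqrt a - sqrt b)\<^sup>2 * c" if "c \<ge> 0" for a b c :: real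
    using that by (simp add: real_sqrt_mult left_diff_distrib[symmetric] power_mult_distrib)
  have oX: "others_prob k P i Y = others_prob k P i X" 
    by (rule others_prob_cong) (simp add: eq)
  have d: "?d s = ?a (?v s) * others_prob k P i X s" for s
    by (simp add: pmf_outcome_split[OF P i] oX split others_prob_nonneg)
  have "hellinger (outcome k P X) (outcome k P Y) = infsum (?d \<circ> snd) ((\<lambda>s. (?v s, s)) ` UNIV)"
    by (subst infsum_reindex) (auto simp: inj_on_def hellinger_def comp_def)
  also have "(\<lambda>s. (?v s, s)) ` UNIV = Sigma UNIV (\<lambda>v. {s. ?v s = v})" by auto
  also have "infsum (?d \<circ> snd) \<dots> = (\<Sum>\<^sub>\<infinity>v. \<Sum>\<^sub>\<infinity>s\<in>{s. ?v s = v}. ?d s)"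
  proof (subst infsum_Sigma_banach[symmetric])
    have "(?d \<circ> snd) summable_on ((\<lambda>s. (?v s, s)) ` UNIV)"
      by (subst summable_on_reindex) (auto simp: inj_on_def comp_def hellinger_summable)
    also have "(\<lambda>s. (?v s, s)) ` UNIV = Sigma UNIV (\<lambda>v. {s. ?v s = v})" by auto
    finally show "(?d \<circ> snd) summable_on (Sigma UNIV (\<lambda>v. {s. ?v s = v}))" .
  qed simp
  also have "\<dots> = (\<Sum>\<^sub>\<infinity>v. ?a v * others_view_prob k P i X v)"
    unfolding others_view_prob_def infsum_cmult_right'[symmetric] 
    by (intro infsum_cong) (simp add: d)
  also have "\<dots> = hellinger (view_pmf k P i X) (view_pmf k P i Y)"
    unfolding hellinger_def
  proof (rule infsum_cong)
    fix v
    have "others_view_prob k P i X v \<ge> 0"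
      by (simp add: others_view_prob_def infsum_nonneg others_prob_nonneg)
    moreover have "others_view_prob k P i Y = others_view_prob k P i X"
      by (rule others_view_prob_cong) (simp add: eq)
    ultimately show "?a v * others_view_prob k P i X v
        = (sqrt (pmf (view_pmf k P i X) v) - sqrt (pmf (view_pmf k P i Y) v))\<^sup>2"
      by (simp add: pmf_view_pmf[OF P i] split)
  qed
  finally show ?thesis .
qed

text \<open>Each row enters the product of the two densities as an unordered pair.\<close>

lemma outcome_cut_and_paste:
  assumes P: "is_protocol k P"
    and "\<And>j. j < k \<Longrightarrow> (X j = X' j \<and> Y j = Y' j) \<or> (X j = Y' j \<and> Y j = X' j)"
  shows "hellinger (outcome k P X) (outcome k P Y) = hellinger (outcome k P X') (outcome k P Y')"
proof (rule hellinger_cut_and_paste)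
  fix s :: "nat \<times> transcript"
  let ?q = "\<lambda>X j. answer_prob P j (X j) (view_of j (snd s))"
  have "(\<Prod>j<k. ?q X j * ?q Y j) = (\<Prod>j<k. ?q X' j * ?q Y' j)"
    by (rule prod.cong) (use assms(2) in force)+
  then show "pmf (outcome k P X) s * pmf (outcome k P Y) s = pmf (outcome k P X') s * pmf (outcome k P Y') s"
    by (simp add: pmf_outcome[OF P] prod.distrib)
qed

lemma prob_result:
  "measure_pmf.prob (coins_pmf k P) {\<rho>. result P \<rho> X} =
    measure_pmf.prob (outcome k P X) {(r, \<tau>). coord P r \<tau> = Halt True}"
  by (simp add: outcome_def measure_map_pmf vimage_def result_def)

lemma hellinger_outcome_ge:
  assumes "error_protocol k \<delta> f P" and "\<delta> < 1/2" and "f X" and "\<not> f Y"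
  shows "(1 - 2 * \<delta>)\<^sup>2 / 4 \<le> hellinger (outcome k P X) (outcome k P Y)"
proof (rule hellinger_ge_prob_gap[OF assms(2)])
  let ?C = "measure_pmf.prob (coins_pmf k P)"
  have err: "1 - \<delta> \<le> ?C {\<rho>. result P \<rho> X = f X}" for X
    using assms(1) by (simp add: error_protocol_def)
  show "1 - \<delta> \<le> measure_pmf.prob (outcome k P X) {(r, \<tau>). coord P r \<tau> = Halt True}"
    using err[of X] assms(3) by (simp add: prob_result[symmetric])
  have "?C (- {\<rho>. result P \<rho> Y}) = 1 - ?C {\<rho>. result P \<rho> Y}"
    using measure_pmf.prob_compl[of "{\<rho>. result P \<rho> Y}" "coins_pmf k P"] by (simp add: Compl_eq_Diff_UNIV)
  then show "measure_pmf.prob (outcome k P Y) {(r, \<tau>). coord P r \<tau> = Halt True} \<le> \<delta>"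
    using err[of Y] assms(4) by (simp add: prob_result[symmetric] Compl_eq)
qed

section \<open>Views under the input distribution\<close>

text \<open>\<open>a\<close> goes to the coordinate that survives the removal of \<open>w\<close>,
  and \<open>b\<close> to coordinate \<open>w\<close>; this treats both values of \<open>W\<close>
  alike.\<close>

definition place :: "nat \<Rightarrow> 'a \<Rightarrow> 'a \<Rightarrow> 'a \<times> 'a" where
  "place w a b = (if w = 1 then (b, a) else (a, b))"

lemma remove_coord_place [simp]: "remove_coord w (place w a b) = a"
  by (simp add: place_def remove_coord_def)

lemma place_eq_iff [simp]: "place w a b = place w a' b' \<longleftrightarrow> a = a' \<and> b = b'"
  by (auto simp: place_def)

definition embed :: "nat \<Rightarrow> (nat \<Rightarrow> bool) \<Rightarrow> matrix" where
  "embed w u = (\<lambda>j. place w (u j) True)"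

definition entry_pmf :: "bool \<Rightarrow> nat \<Rightarrow> nat \<Rightarrow> bool pmf" where
  "entry_pmf m z i = (if i = z then return_pmf False
     else if m then return_pmf True else bernoulli_pmf (1/2))"

lemma bind_column_pmf:
  "bind_pmf (column_pmf k) (\<lambda>(x, m, z). f x m z) =
    do { m \<leftarrow> bernoulli_pmf (1/3); z \<leftarrow> pmf_of_set {..<k};
         x \<leftarrow> Pi_pmf {..<k} False (entry_pmf m z); f x m z }"
  by (simp add: column_pmf_def bind_assoc_pmf bind_return_pmf entry_pmf_def[abs_def])

text \<open>Drawing \<open>W\<close> first leaves a single random column \<open>u\<close>, with
  parameters \<open>m\<close> and \<open>z\<close>. The overwritten column leaves only its
  parameters \<open>m'\<close> and \<open>z'\<close>.\<close>

lemma zeta2_eq: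
  "zeta2 k = do { w \<leftarrow> pmf_of_set {1, 2};
     m \<leftarrow> bernoulli_pmf (1/3); z \<leftarrow> pmf_of_set {..<k};
     m' \<leftarrow> bernoulli_pmf (1/3); z' \<leftarrow> pmf_of_set {..<k};
     u \<leftarrow> Pi_pmf {..<k} False (entry_pmf m z);
     return_pmf (embed w u, place w m m', place w z z', w) }"
proof -
  let ?b = "bernoulli_pmf (1/3)" and ?z = "pmf_of_set {..<k}"
  let ?g = "\<lambda>w u m z (u'::nat \<Rightarrow> bool) m' z'. return_pmf (embed w u, place w m m', place w z z', w)"
  have "zeta2 k = do { w \<leftarrow> pmf_of_set {1, 2}; (u1, m1, z1) \<leftarrow> column_pmf k; (u2, m2, z2) \<leftarrow> column_pmf k;
      return_pmf (\<lambda>i. (if w = 1 then True else u1 i, if w = 2 then True else u2 i),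
         (m1, m2), (z1, z2), w) }"
    unfolding zeta2_def case_prod_unfold
    by (subst (2) bind_commute_pmf, subst bind_commute_pmf) (rule refl)
  also have "\<dots> = do { w \<leftarrow> pmf_of_set {1, 2}; (u, m, z) \<leftarrow> column_pmf k; (u', m', z') \<leftarrow> column_pmf k;
      ?g w u m z u' m' z' }"
  proof (rule bind_pmf_cong[OF refl])
    fix w :: nat assume "w \<in> set_pmf (pmf_of_set {1, 2})"
    then consider "w = 1" | "w = 2" by auto
    then show "do { (u1, m1, z1) \<leftarrow> column_pmf k; (u2, m2, z2) \<leftarrow> column_pmf k;
      return_pmf (\<lambda>i. (if w = 1 then True else u1 i, if w = 2 then True else u2 i),
         (m1, m2), (z1, z2), w) } =
      do { (u, m, z) \<leftarrow> column_pmf k; (u', m', z') \<leftarrow> column_pmf k; ?g w u m z u' m' z' }"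
    proof cases
      case 1
      then show ?thesis
        unfolding case_prod_unfold
        by (subst bind_commute_pmf) (simp add: embed_def place_def)
    next
      case 2
      then show ?thesis by (simp add: embed_def place_def)
    qed
  qed
  also have "\<dots> = do { w \<leftarrow> pmf_of_set {1, 2};
     m \<leftarrow> ?b; z \<leftarrow> ?z; u \<leftarrow> Pi_pmf {..<k} False (entry_pmf m z);
     m' \<leftarrow> ?b; z' \<leftarrow> ?z; return_pmf (embed w u, place w m m', place w z z', w) }"
    by (simp add: bind_column_pmf bind_pmf_const)
  also have "\<dots> = do { w \<leftarrow> pmf_of_set {1, 2};
     m \<leftarrow> ?b; z \<leftarrow> ?z; m' \<leftarrow> ?b; z' \<leftarrow> ?z; u \<leftarrow> Pi_pmf {..<k} False (entry_pmf m z);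
     return_pmf (embed w u, place w m m', place w z z', w) }"
  proof (intro bind_pmf_cong refl)
    fix w m z
    let ?U = "Pi_pmf {..<k} False (entry_pmf m z)"
    have "do { u \<leftarrow> ?U; m' \<leftarrow> ?b; z' \<leftarrow> ?z; return_pmf (embed w u, place w m m', place w z z', w) } =
      do { m' \<leftarrow> ?b; u \<leftarrow> ?U; z' \<leftarrow> ?z; return_pmf (embed w u, place w m m', place w z z', w) }"
      by (rule bind_commute_pmf)
    also have "\<dots> = do { m' \<leftarrow> ?b; z' \<leftarrow> ?z; u \<leftarrow> ?U; return_pmf (embed w u, place w m m', place w z z', w) }"
      by (intro bind_pmf_cong refl bind_commute_pmf)
    finally show "do { u \<leftarrow> ?U; m' \<leftarrow> ?b; z' \<leftarrow> ?z; return_pmf (embed w u, place w m m', place w z z', w) } =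
      do { m' \<leftarrow> ?b; z' \<leftarrow> ?z; u \<leftarrow> ?U; return_pmf (embed w u, place w m m', place w z z', w) }" .
  qed
  finally show ?thesis .
qed

lemma pmf_bind_Pair:
  "pmf (bind_pmf Q (\<lambda>t. map_pmf (Pair t) (K t))) (t, y) = pmf Q t * pmf (K t) y"
proof -
  have "pmf (map_pmf (Pair t') (K t')) (t, y) = indicator {t} t' * pmf (K t) y" for t'
  proof (cases "t' = t")
    case True
    then show ?thesis by (simp add: pmf_map_inj' inj_def)
  next
    case False
    then have "pmf (map_pmf (Pair t') (K t')) (t, y) = 0" by (intro pmf_map_outside) auto
    then show ?thesis using False by simp
  qed
  then show ?thesis by (simp add: pmf_bind measure_pmf_single)
qed

text \<open>
  The law of \<open>\<Pi>\<^sup>i\<close> given \<open>W = w\<close>, \<open>Z\<^sub>-\<^sub>W = z\<close>, \<open>X\<^sup>i\<^sub>-\<^sub>W = x\<close>, \<open>M\<^sub>-\<^sub>W = m\<close>. It also makes sense for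
  \<open>x = 0\<close>, \<open>m = 1\<close>, which has probability zero under \<open>\<zeta>\<^sub>2\<close> when \<open>i \<noteq> z\<close> but is reached by cut and paste.
\<close>

definition mixed_view :: "nat \<Rightarrow> protocol \<Rightarrow> nat \<Rightarrow> nat \<Rightarrow> nat \<Rightarrow> bool \<Rightarrow> bool \<Rightarrow> view pmf" where
  "mixed_view k P i w z x m =
    bind_pmf (Pi_pmf ({..<k} - {i}) False (entry_pmf m z)) (\<lambda>u. view_pmf k P i (embed w (u(i := x))))"

text \<open>The law of \<open>(((W, M\<^sub>-\<^sub>W, Z\<^sub>-\<^sub>W), M\<^sub>W, Z\<^sub>W), X\<^sup>i\<^sub>-\<^sub>W, \<Pi>\<^sup>i)\<close>.\<close>

definition joint :: "nat \<Rightarrow> protocol \<Rightarrow> nat \<Rightarrow> (((nat \<times> bool \<times> nat) \<times> bool \<times> nat) \<times> bool \<times> view) pmf" where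
  "joint k P i =
    bind_pmf (pair_pmf (pair_pmf (pmf_of_set {1, 2}) (pair_pmf (bernoulli_pmf (1/3)) (pmf_of_set {..<k})))
        (pair_pmf (bernoulli_pmf (1/3)) (pmf_of_set {..<k})))
      (\<lambda>t. map_pmf (Pair t) (case t of ((w, m, z), m', z') \<Rightarrow>
         bind_pmf (entry_pmf m z i) (\<lambda>x. map_pmf (Pair x) (mixed_view k P i w z x m))))"

lemma pmf_joint:
  "pmf (joint k P i) (((w, m, z), m', z'), x, v) =
    pmf (pmf_of_set {1, 2}) w * (pmf (bernoulli_pmf (1/3)) m * pmf (pmf_of_set {..<k}) z) *
    (pmf (bernoulli_pmf (1/3)) m' * pmf (pmf_of_set {..<k}) z') *
    (pmf (entry_pmf m z i) x * pmf (mixed_view k P i w z x m) v)"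
  by (simp add: joint_def pmf_bind_Pair pmf_pair)

text \<open>Splits the free column into the entry of \<open>i\<close> and the rest, independent
  given \<open>m\<close> and \<open>z\<close>. The function \<open>f\<close> is arbitrary so that
  both information terms are covered.\<close>

lemma map_zeta2_eq_joint:
  assumes "i < k"
  shows "map_pmf (\<lambda>((X, M, Z, W), \<rho>). f W M Z (X i) (view_of i (full_transcript P \<rho> X)))
      (pair_pmf (zeta2 k) (coins_pmf k P)) =
    map_pmf (\<lambda>(((w, m, z), m', z'), x, v). f w (place w m m') (place w z z') (place w x True) v)
      (joint k P i)"
proof -
  have U: "Pi_pmf {..<k} False (entry_pmf m z) =
      do { x \<leftarrow> entry_pmf m z i; u \<leftarrow> Pi_pmf ({..<k} - {i}) False (entry_pmf m z); return_pmf (u(i := x)) }"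
    for m z
    using Pi_pmf_insert'[of "{..<k} - {i}" i False "entry_pmf m z"] assms
    by (simp add: insert_absorb)
  show ?thesis
    by (simp add: zeta2_eq joint_def mixed_view_def view_pmf_def pair_pmf_def map_pmf_def U
        bind_assoc_pmf bind_return_pmf embed_def)
qed

text \<open>Given \<open>m\<close> and \<open>z\<close> the other entries are drawn independently of
  \<open>x\<close>, so the averaged density is still a factor in \<open>x\<close> times a factor in
  \<open>m\<close>.\<close>

lemma mixed_view_factor:
  assumes "is_protocol k P" and "i < k"
  shows "pmf (mixed_view k P i w z x m) v = answer_prob P i (place w x True) v *
    (\<integral>u. others_view_prob k P i (embed w u) v \<partial>Pi_pmf ({..<k} - {i}) False (entry_pmf m z))"
proof -
  have "others_view_prob k P i (embed w (u(i := x))) = others_view_prob k P i (embed w u)" for u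
    by (rule others_view_prob_cong) (simp add: embed_def)
  then show ?thesis
    by (simp add: mixed_view_def pmf_bind pmf_view_pmf[OF assms]) (simp add: embed_def)
qed

text \<open>A two-party cut and paste: one party holds \<open>x\<close>, and \<open>m\<close> plays
  the input of everyone else.\<close>

lemma hellinger_mixed_view_cut_and_paste:
  assumes "is_protocol k P" and "i < k"
  shows "hellinger (mixed_view k P i w z x m) (mixed_view k P i w z x' m') =
    hellinger (mixed_view k P i w z x m') (mixed_view k P i w z x' m)"
  by (rule hellinger_cut_and_paste) (simp add: mixed_view_factor[OF assms])

lemma mixed_view_True:
  assumes "is_protocol k P" and "i < k" and "z \<noteq> i"
  shows "mixed_view k P i w z x True =
    view_pmf k P i (embed w (\<lambda>j. j \<notin> (if x then {z} else {i, z})))"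
proof -
  have "Pi_pmf ({..<k} - {i}) False (entry_pmf True z) =
      Pi_pmf ({..<k} - {i}) False (\<lambda>j. return_pmf (j \<noteq> z))"
    by (rule Pi_pmf_cong) (auto simp: entry_pmf_def)
  then show ?thesis
    using assms
    by (auto simp: mixed_view_def bind_return_pmf view_pmf_eq_map_outcome embed_def
        intro!: arg_cong[of _ _ "map_pmf _"] outcome_cong)
qed

section \<open>Comparison of columns with one and two zeros\<close>

definition zeros_outcome :: "nat \<Rightarrow> protocol \<Rightarrow> nat \<Rightarrow> nat set \<Rightarrow> (nat \<times> transcript) pmf" where
  "zeros_outcome k P w S = outcome k P (embed w (\<lambda>j. j \<notin> S))"

lemma hellinger_zeros_le_mixed_view:
  assumes "is_protocol k P" and "i < k" and "z \<noteq> i"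
  shows "hellinger (zeros_outcome k P w {z}) (zeros_outcome k P w {i, z}) \<le>
    6 * (hellinger (mixed_view k P i w z True True) (mixed_view k P i w z True False) +
         hellinger (mixed_view k P i w z True False) (mixed_view k P i w z False False))"
proof -
  let ?V = "mixed_view k P i w z"
  have "hellinger (zeros_outcome k P w {z}) (zeros_outcome k P w {i, z}) = hellinger (?V True True) (?V False True)"
    unfolding zeros_outcome_def
    by (subst hellinger_outcome_eq_view[OF assms(1,2)])
      (use assms in \<open>auto simp: embed_def mixed_view_True\<close>)
  also have "\<dots> \<le> 2 * hellinger (?V True True) (?V True False) + 2 * hellinger (?V True False) (?V False True)"
    by (rule hellinger_triangle)
  \<comment> \<open>Trades \<open>(x, m) = (0, 1)\<close>, about which the information terms say
    nothing, for \<open>(0, 0)\<close>.\<close>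
  also have "hellinger (?V True False) (?V False True) = hellinger (?V True True) (?V False False)"
    by (rule hellinger_mixed_view_cut_and_paste[OF assms(1,2)])
  also have "\<dots> \<le> 2 * hellinger (?V True True) (?V True False) + 2 * hellinger (?V True False) (?V False False)"
    by (rule hellinger_triangle)
  finally show ?thesis using hellinger_nonneg[of "?V True False" "?V False False"] by simp
qed

section \<open>The lower bound\<close>

lemma pmf_of_set_lessThan: "z < k \<Longrightarrow> pmf (pmf_of_set {..<k}) z = 1 / real k"
  by (subst pmf_of_set) auto

text \<open>Restricts the conditioning to value 0 of the surviving mode, where the entry of
  \<open>i\<close> is a fair bit for \<open>z \<noteq> i\<close>.\<close>

lemma entry_information_ge:
  assumes i: "i < k"
  shows "(\<Sum>w\<in>{1, 2}. \<Sum>z\<in>{..<k} - {i}.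
      hellinger (mixed_view k P i w z True False) (mixed_view k P i w z False False)) \<le>
    12 * real k * cond_mutual_info (pair_pmf (zeta2 k) (coins_pmf k P))
      (\<lambda>((X, M, Z, W), \<rho>). remove_coord W (X i))
      (\<lambda>((X, M, Z, W), \<rho>). view_of i (full_transcript P \<rho> X))
      (\<lambda>((X, M, Z, W), \<rho>). (M, Z, W))" (is "_ \<le> 12 * real k * cond_mutual_info ?p ?A ?B ?C")
proof -
  define T where "T = {1::nat, 2} \<times> ({..<k} - {i}) \<times> (UNIV::bool set) \<times> {..<k}"
  let ?\<iota> = "\<lambda>(w, z, m', z'). (place w False m', place w z z', w)"
  \<comment> \<open>The 6 collects \<open>1/2\<close> for \<open>w\<close>, \<open>2/3\<close> for
    mode 0 and \<open>1/2\<close> for the entry. The views do not depend on \<open>m'\<close> and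
    \<open>z'\<close>, so summing these out leaves \<open>1 / (6 k)\<close>.\<close>
  let ?\<alpha> = "\<lambda>(w::nat, z::nat, m', z'::nat). pmf (bernoulli_pmf (1/3)) m' / (6 * (real k)\<^sup>2)"
  let ?V = "\<lambda>x (w, z, m'::bool, z'::nat). mixed_view k P i w z x False"
  let ?\<phi> = "\<lambda>(((w, m, z), m', z'), x, v). (x, v, place w m m', place w z z', w)"
  have k: "k > 0" using i by simp
  have "(\<lambda>s. (?A s, ?B s, ?C s)) =
      (\<lambda>((X, M, Z, W), \<rho>). (remove_coord W (X i), view_of i (full_transcript P \<rho> X), M, Z, W))"
    by auto
  then have map: "map_pmf (\<lambda>s. (?A s, ?B s, ?C s)) ?p = map_pmf ?\<phi> (joint k P i)"
    using map_zeta2_eq_joint[OF i, where f="\<lambda>W M Z r v. (remove_coord W r, v, M, Z, W)" and P=P]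
    by simp
  have J: "pmf (map_pmf (\<lambda>s. (?A s, ?B s, ?C s)) ?p) (x, v, ?\<iota> t) = ?\<alpha> t * pmf (?V x t) v"
    if "t \<in> T" for x v t
  proof (cases t)
    case (fields w z m' z')
    have wz: "w \<in> {1, 2}" "z < k" "z \<noteq> i" "z' < k" using that by (auto simp: T_def fields)
    have "pmf (map_pmf ?\<phi> (joint k P i)) (?\<phi> (((w, False, z), m', z'), x, v)) =
        pmf (joint k P i) (((w, False, z), m', z'), x, v)"
      by (rule pmf_map_inj') (auto simp: inj_def)
    also have "\<dots> = ?\<alpha> t * pmf (?V x t) v"
      using wz k by (cases x) (auto simp: pmf_joint pmf_of_set_lessThan entry_pmf_def fields power2_eq_square)
    finally show ?thesis by (simp add: map fields)
  qed
  have "(\<Sum>w\<in>{1, 2}. \<Sum>z\<in>{..<k} - {i}.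
      hellinger (mixed_view k P i w z True False) (mixed_view k P i w z False False)) =
      6 * real k * (\<Sum>t\<in>T. ?\<alpha> t * hellinger (?V True t) (?V False t))"
    unfolding T_def sum.cartesian_product' prod.case
    using k by (simp add: UNIV_bool sum_distrib_left[symmetric] sum_divide_distrib[symmetric] power2_eq_square
        field_simps sum.distrib)
  also have "\<dots> \<le> 6 * real k * (2 * cond_mutual_info ?p ?A ?B ?C)"
  proof (intro mult_left_mono cond_mutual_info_ge_mixture)
    show "finite T" by (simp add: T_def)
    show "inj_on ?\<iota> T" by (auto simp: inj_on_def)
    show "0 \<le> ?\<alpha> t" for t by (simp split: prod.split)
  qed (use J in auto)
  finally show ?thesis by simp
qed

text \<open>Restricts the conditioning to surviving entry 1. Both modes are then equally likely,
  since \<open>2/3 * 1/2 = 1/3 * 1\<close>; this balance is what the probability \<open>1/3\<close>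
  for mode 1 provides.\<close>

lemma mode_information_ge:
  assumes i: "i < k"
  shows "(\<Sum>w\<in>{1, 2}. \<Sum>z\<in>{..<k} - {i}.
      hellinger (mixed_view k P i w z True True) (mixed_view k P i w z True False)) \<le>
    12 * real k * cond_mutual_info (pair_pmf (zeta2 k) (coins_pmf k P))
      (\<lambda>((X, M, Z, W), \<rho>). remove_coord W M)
      (\<lambda>((X, M, Z, W), \<rho>). view_of i (full_transcript P \<rho> X))
      (\<lambda>((X, M, Z, W), \<rho>). (X i, Z, W))" (is "_ \<le> 12 * real k * cond_mutual_info ?p ?A ?B ?C")
proof -
  define T where "T = {1::nat, 2} \<times> ({..<k} - {i}) \<times> {..<k}"
  let ?\<iota> = "\<lambda>(w, z, z'). (place w True True, place w z z', w)"
  let ?\<alpha> = "\<lambda>(w::nat, z::nat, z'::nat). 1 / (6 * (real k)\<^sup>2)"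
  let ?V = "\<lambda>m (w, z, z'::nat). mixed_view k P i w z True m"
  \<comment> \<open>Here \<open>M\<close> is not conditioned on, so \<open>?\<phi>\<close> forgets
    \<open>m'\<close>. Adjoining \<open>?\<mu>\<close> restores injectivity, and the two values of
    \<open>m'\<close> are summed afterwards.\<close>
  let ?\<mu> = "\<lambda>(((w::nat, m::bool, z::nat), m'::bool, z'::nat), x::bool, v::view). m'"
  let ?\<phi> = "\<lambda>(((w, m, z), m', z'), x, v). (m, v, place w x True, place w z z', w)"
  have k: "k > 0" using i by simp
  have "(\<lambda>s. (?A s, ?B s, ?C s)) =
      (\<lambda>((X, M, Z, W), \<rho>). (remove_coord W M, view_of i (full_transcript P \<rho> X), X i, Z, W))"
    by auto
  then have map: "map_pmf (\<lambda>s. (?A s, ?B s, ?C s)) ?p = map_pmf ?\<phi> (joint k P i)"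
    using map_zeta2_eq_joint[OF i, where f="\<lambda>W M Z r v. (remove_coord W M, v, r, Z, W)" and P=P]
    by simp
  have J: "pmf (map_pmf (\<lambda>s. (?A s, ?B s, ?C s)) ?p) (m, v, ?\<iota> t) = ?\<alpha> t * pmf (?V m t) v"
    if "t \<in> T" for m v t
  proof (cases t)
    case (fields w z z')
    have wz: "w \<in> {1, 2}" "z < k" "z \<noteq> i" "z' < k" using that by (auto simp: T_def fields)
    have 1: "pmf (map_pmf (\<lambda>s. (?\<mu> s, ?\<phi> s)) (joint k P i)) (m', m, v, ?\<iota> t) =
        pmf (joint k P i) (((w, m, z), m', z'), True, v)" for m'
    proof -
      have "inj (\<lambda>s. (?\<mu> s, ?\<phi> s))" by (auto simp: inj_def)
      from pmf_map_inj'[OF this, of "joint k P i" "(((w, m, z), m', z'), True, v)"]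
      show ?thesis by (simp add: fields)
    qed
    have "pmf (map_pmf ?\<phi> (joint k P i)) (m, v, ?\<iota> t) =
        pmf (joint k P i) (((w, m, z), True, z'), True, v) + pmf (joint k P i) (((w, m, z), False, z'), True, v)"
      unfolding 1[symmetric] by (rule pmf_map_bool_marginal[symmetric])
    also have "\<dots> = ?\<alpha> t * pmf (?V m t) v"
      using wz k by (cases m) (auto simp: pmf_joint pmf_of_set_lessThan entry_pmf_def fields power2_eq_square field_simps)
    finally show ?thesis by (simp add: map)
  qed
  have "(\<Sum>w\<in>{1, 2}. \<Sum>z\<in>{..<k} - {i}.
      hellinger (mixed_view k P i w z True True) (mixed_view k P i w z True False)) =
      6 * real k * (\<Sum>t\<in>T. ?\<alpha> t * hellinger (?V True t) (?V False t))"
    unfolding T_def sum.cartesian_product' prod.case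
    using k by (simp add: sum_distrib_left[symmetric] sum_divide_distrib[symmetric] power2_eq_square
        field_simps)
  also have "\<dots> \<le> 6 * real k * (2 * cond_mutual_info ?p ?A ?B ?C)"
  proof (intro mult_left_mono cond_mutual_info_ge_mixture)
    show "finite T" by (simp add: T_def)
    show "inj_on ?\<iota> T" by (auto simp: inj_on_def)
    show "0 \<le> ?\<alpha> t" for t by (simp split: prod.split)
  qed (use J in auto)
  finally show ?thesis by simp
qed

section \<open>Summation over pairs of processors\<close>

lemma PIC_prot_ge_hellinger:
  assumes "is_protocol k P"
  shows "(\<Sum>i<k. \<Sum>w\<in>{1, 2}. \<Sum>z\<in>{..<k} - {i}.
      hellinger (zeros_outcome k P w {z}) (zeros_outcome k P w {i, z})) \<le> 72 * real k * PIC_prot k P"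
  unfolding PIC_prot_def sum_distrib_left
proof (rule sum_mono)
  fix i assume "i \<in> {..<k}"
  then have i: "i < k" by simp
  let ?V = "mixed_view k P i"
  have "(\<Sum>w\<in>{1, 2}. \<Sum>z\<in>{..<k} - {i}.
      hellinger (zeros_outcome k P w {z}) (zeros_outcome k P w {i, z})) \<le>
    (\<Sum>w\<in>{1, 2}. \<Sum>z\<in>{..<k} - {i}.
      6 * (hellinger (?V w z True True) (?V w z True False) + hellinger (?V w z True False) (?V w z False False)))"
    by (intro sum_mono hellinger_zeros_le_mixed_view[OF assms i]) auto
  also have "\<dots> = 6 * ((\<Sum>w\<in>{1, 2}. \<Sum>z\<in>{..<k} - {i}. hellinger (?V w z True True) (?V w z True False)) +
      (\<Sum>w\<in>{1, 2}. \<Sum>z\<in>{..<k} - {i}. hellinger (?V w z True False) (?V w z False False)))"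
    by (simp only: sum_distrib_left[symmetric] sum.distrib)
  finally show "(\<Sum>w\<in>{1, 2}. \<Sum>z\<in>{..<k} - {i}.
      hellinger (zeros_outcome k P w {z}) (zeros_outcome k P w {i, z})) \<le> 72 * real k *
    (cond_mutual_info (pair_pmf (zeta2 k) (coins_pmf k P))
        (\<lambda>((X, M, Z, W), \<rho>). remove_coord W M)
        (\<lambda>((X, M, Z, W), \<rho>). view_of i (full_transcript P \<rho> X))
        (\<lambda>((X, M, Z, W), \<rho>). (X i, Z, W))
    + cond_mutual_info (pair_pmf (zeta2 k) (coins_pmf k P))
        (\<lambda>((X, M, Z, W), \<rho>). remove_coord W (X i))
        (\<lambda>((X, M, Z, W), \<rho>). view_of i (full_transcript P \<rho> X))
        (\<lambda>((X, M, Z, W), \<rho>). (M, Z, W)))"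
    \<comment> \<open>The constant is \<open>72 = 6 * 12\<close>.\<close>
    using mode_information_ge[OF i, of P] entry_information_ge[OF i, of P] by (simp only: distrib_left)
qed

lemma hellinger_single_zero_le:
  assumes "is_protocol k P" and "i \<noteq> z"
  shows "hellinger (zeros_outcome k P w {i}) (zeros_outcome k P w {}) \<le>
    6 * (hellinger (zeros_outcome k P w {z}) (zeros_outcome k P w {i, z}) +
         hellinger (zeros_outcome k P w {i}) (zeros_outcome k P w {i, z}))"
proof -
  let ?T = "zeros_outcome k P w"
  have "hellinger (?T {i}) (?T {}) \<le> 2 * hellinger (?T {i}) (?T {i, z}) + 2 * hellinger (?T {i, z}) (?T {})"
    by (rule hellinger_triangle)
  \<comment> \<open>Exchanging row \<open>z\<close> turns zero sets \<open>{i, z}\<close> and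
    \<open>{}\<close> into \<open>{i}\<close> and \<open>{z}\<close>.\<close>
  also have "hellinger (?T {i, z}) (?T {}) = hellinger (?T {i}) (?T {z})"
    unfolding zeros_outcome_def
    by (rule outcome_cut_and_paste[OF assms(1)]) (use assms(2) in \<open>auto simp: embed_def\<close>)
  also have "\<dots> \<le> 2 * hellinger (?T {i}) (?T {i, z}) + 2 * hellinger (?T {i, z}) (?T {z})"
    by (rule hellinger_triangle)
  finally show ?thesis
    using hellinger_nonneg[of "?T {z}" "?T {i, z}"] by (simp add: hellinger_commute[of "?T {i, z}"])
qed

lemma hellinger_pair_ge:
  assumes err: "error_protocol k \<delta> (Disj2 k) P" and "\<delta> < 1/2" and "i < k" "z < k" "i \<noteq> z"
  shows "(1 - 2 * \<delta>)\<^sup>2 / 48 \<le> (\<Sum>w\<in>{1, 2}.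
      hellinger (zeros_outcome k P w {z}) (zeros_outcome k P w {i, z}) +
      hellinger (zeros_outcome k P w {i}) (zeros_outcome k P w {i, z}))" (is "_ \<le> (\<Sum>w\<in>{1, 2}. ?D w)")
proof -
  let ?T = "zeros_outcome k P"
  have P: "is_protocol k P" using err by (simp add: error_protocol_def)
  have "(1 - 2 * \<delta>)\<^sup>2 / 4 \<le> hellinger (outcome k P (\<lambda>j. (True, True))) (outcome k P (\<lambda>j. (j \<noteq> i, j \<noteq> z)))"
    by (rule hellinger_outcome_ge[OF err \<open>\<delta> < 1/2\<close>]) (use assms in \<open>auto simp: Disj2_def col_def\<close>)
  \<comment> \<open>Exchanging row \<open>i\<close> distributes the two zeros over two matrices,
    each of which keeps one column of ones.\<close>
  also have "\<dots> = hellinger (?T 2 {i}) (?T 1 {z})"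
    unfolding zeros_outcome_def
    by (rule outcome_cut_and_paste[OF P]) (use \<open>i \<noteq> z\<close> in \<open>auto simp: embed_def place_def\<close>)
  also have "\<dots> \<le> 2 * hellinger (?T 2 {i}) (?T 2 {}) + 2 * hellinger (?T 2 {}) (?T 1 {z})"
    by (rule hellinger_triangle)
  \<comment> \<open>The all-ones matrix links the two choices of the column of ones.\<close>
  also have "?T 2 {} = ?T 1 {}"
    unfolding zeros_outcome_def by (rule outcome_cong[OF P]) (simp add: embed_def place_def)
  finally have "(1 - 2 * \<delta>)\<^sup>2 / 4 \<le> 2 * hellinger (?T 2 {i}) (?T 2 {}) + 2 * hellinger (?T 1 {z}) (?T 1 {})"
    using \<open>?T 2 {} = ?T 1 {}\<close> by (simp add: hellinger_commute)
  moreover have "hellinger (?T 2 {i}) (?T 2 {}) \<le> 6 * ?D 2"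
    by (rule hellinger_single_zero_le[OF P \<open>i \<noteq> z\<close>])
  moreover have "hellinger (?T 1 {z}) (?T 1 {}) \<le> 6 * ?D 1"
    using hellinger_single_zero_le[OF P \<open>i \<noteq> z\<close>[symmetric], of 1]
    by (simp add: insert_commute add.commute)
  ultimately show ?thesis by simp
qed

lemma PIC_prot_ge:
  assumes err: "error_protocol k \<delta> (Disj2 k) P" and "\<delta> < 1/2" and "k \<ge> 2"
  shows "(1 - 2 * \<delta>)\<^sup>2 / 13824 * real k \<le> PIC_prot k P"
proof -
  define E where "E = (\<lambda>i z. \<Sum>w\<in>{1, 2}. hellinger (zeros_outcome k P w {z}) (zeros_outcome k P w {i, z}))"
  define g where "g = (1 - 2 * \<delta>)\<^sup>2"
  have P: "is_protocol k P" using err by (simp add: error_protocol_def)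
  have pair: "g / 48 \<le> E i z + E z i" if "i < k" "z < k" "i \<noteq> z" for i z
    using hellinger_pair_ge[OF err \<open>\<delta> < 1/2\<close> that]
    by (simp add: g_def E_def insert_commute sum.distrib)
  have "real k * (real k - 1) * (g / 48) = (\<Sum>i<k. \<Sum>z\<in>{..<k} - {i}. g / 48)"
    using \<open>k \<ge> 2\<close> by (simp add: of_nat_diff)
  also have "\<dots> \<le> (\<Sum>i<k. \<Sum>z\<in>{..<k} - {i}. E i z + E z i)"
    by (intro sum_mono pair) auto
  also have "\<dots> = (\<Sum>i<k. \<Sum>z\<in>{..<k} - {i}. E i z) + (\<Sum>i<k. \<Sum>z\<in>{..<k} - {i}. E z i)"
    by (simp add: sum.distrib)
  \<comment> \<open>By symmetry over ordered pairs both halves equal the sum already bounded by the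
    information cost.\<close>
  also have "(\<Sum>i<k. \<Sum>z\<in>{..<k} - {i}. E z i) = (\<Sum>z<k. \<Sum>i\<in>{..<k} - {z}. E z i)"
    using sum.swap_restrict[of "{..<k}" "{..<k}" "\<lambda>i z. E z i" "\<lambda>i z. z \<noteq> i"]
    by (simp add: set_diff_eq Collect_conj_eq lessThan_def[symmetric] conj_commute eq_commute)
  also have "(\<Sum>i<k. \<Sum>z\<in>{..<k} - {i}. E i z) + (\<Sum>i<k. \<Sum>z\<in>{..<k} - {i}. E i z) \<le> 2 * (72 * real k * PIC_prot k P)"
    using PIC_prot_ge_hellinger[OF P] unfolding E_def by (subst (1 2) sum.swap[of _ "{1, 2}"]) simp
  finally have "real k * ((real k - 1) * (g / 48)) \<le> real k * (144 * PIC_prot k P)"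
    by (simp add: algebra_simps)
  then have "(real k - 1) * (g / 48) \<le> 144 * PIC_prot k P"
    using \<open>k \<ge> 2\<close> by simp
  \<comment> \<open>Uses \<open>k - 1 >= k / 2\<close>; the final constant is
    \<open>13824 = 2 * 48 * 144\<close>.\<close>
  moreover have "real k / 2 * (g / 48) \<le> (real k - 1) * (g / 48)"
    using \<open>k \<ge> 2\<close> by (intro mult_right_mono) (auto simp: g_def)
  ultimately have "real k / 2 * (g / 48) \<le> 144 * PIC_prot k P" by (rule order_trans[rotated])
  then show ?thesis unfolding g_def[symmetric] by (simp add: mult.commute)
qed

theorem theorem4:
  fixes \<delta> :: real
  assumes "0 \<le> \<delta>" and "\<delta> < 1/2"
  shows "\<exists>c::real. c > 0 \<and> (\<forall>k::nat. k \<ge> 2 \<longrightarrow> PIC k \<delta> (Disj2 k) \<ge> ereal (c * real k))"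
proof (intro exI conjI allI impI)
  show "0 < (1 - 2 * \<delta>)\<^sup>2 / 13824" using assms by simp
  fix k :: nat assume "k \<ge> 2"
  then show "ereal ((1 - 2 * \<delta>)\<^sup>2 / 13824 * real k) \<le> PIC k \<delta> (Disj2 k)"
    unfolding PIC_def 
    by (intro INF_greatest) (simp only: ereal_less_eq mem_Collect_eq PIC_prot_ge[OF _ assms(2)])
qed

end
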